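(* To every pair $(b,\Psi)\in\mathbb{R}_+\times\mathcal{LE}(0,\infty)$ is associated a (unique) function $F=\Theta(b,\Psi)$ in $\mathcal{N}(\mathbb{R}_+)$, obtained by the operator $\Theta$ given, for all $z\in\mathbb{C}^+$, by $$\Theta(b,\Psi)(z)=F(z):=z^2\int_0^\infty e^{-zu}\,\big(b+\Psi(0)-\Psi(u)\big)\,du=a+bz+\int_{[0,\infty)}\frac{zx-1}{z+x}\,\rho(dx),$$ where the characteristics $(a,\rho)$ of $F$ are related to the characteristics $(\alpha,\beta,\gamma,\nu)$ of $\Psi$ by $$a=-\beta\qquad\text{and}\qquad\rho(dx)=\gamma^2\,\delta_0(dx)+\frac{x^2}{1+x^2}\,\nu(dx).$$ Furthermore, the class of functions $$\mathcal{N}^\star(\mathbb{R}_+):=\Big\{F\in\mathcal{N}(\mathbb{R}_+)\ \text{ such that }\ b=\lim_{|z|\to\infty,\ z\in\mathbb{C}^+}\frac{F(z)}{z}=0\Big\}$$ is obtained as the image of $\{0\}\times\mathcal{LE}(0,\infty)$ by the operator $\Theta$.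
   Context: $\mathbb{C}^+=\{z\in\mathbb{C}:\Re(z)>0\}$, $\mathbb{R}_+=[0,\infty)$, and $\delta_0$ is the Dirac mass at $0$. $\mathcal{N}(\mathbb{R}_+)$ is the set of Nevanlinna-Pick functions whose measure is concentrated on $[0,\infty)$, i.e. functions of the form $F(z)=a+bz+\int_{[0,\infty)}\frac{zx-1}{z+x}\rho(dx)$ with $a\in\mathbb{R}$, $b\ge0$ and $\rho$ a finite Borel measure on $[0,\infty)$. The triple $(a,b,\rho)$ is uniquely determined by $F$, and such a function is regarded as an analytic function on $\mathbb{C}\setminus(-\infty,0]$, so in particular on $\mathbb{C}^+$. $\mathcal{LE}(0,\infty)$ is the set of Lévy-Laplace exponents with Lévy measure supported by $(0,\infty)$, i.e. functions $$\Psi(\lambda)=\alpha+\beta\lambda+\frac{\gamma^2}{2}\lambda^2+\int_{(0,\infty)}\Big(e^{-\lambda x}-1+\lambda\frac{x}{1+x^2}\Big)\nu(dx),\qquad\lambda\ge0,$$ with $\alpha,\gamma\ge0$, $\beta\in\mathbb{R}$, and $\nu$ a measure on $(0,\infty)$ such that $\int_{(0,\infty)}(x^2\wedge1)\,\nu(dx)<\infty$. The quadruple $(\alpha,\beta,\gamma,\nu)$ is called the characteristics of $\Psi$. *)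

theory Defs
  imports "HOL-Complex_Analysis.Complex_Analysis" "HOL-Probability.Probability"
begin

definition C_plus :: "complex set" where
  "C_plus = {z. Re z > 0}"

text \<open>
  A function on \<open>\<complex> \<setminus> (-\<infinity>, 0]\<close> is modelled as a total function that is \<open>undefined\<close> on
  \<open>(-\<infinity>, 0]\<close>, so that equality in HOL is equality of functions on the slit plane. In the same way
  a function on \<open>[0, \<infinity>)\<close> is \<open>undefined\<close> on the negative reals. Measures on \<open>[0, \<infinity>)\<close> and on
  \<open>(0, \<infinity>)\<close> are Borel measures on the real line giving mass zero to the complement.
\<close>

definition NP_characteristics ::
  "(complex \<Rightarrow> complex) \<Rightarrow> real \<Rightarrow> real \<Rightarrow> real measure \<Rightarrow> bool" where
  "NP_characteristics F a b \<rho> \<longleftrightarrow>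
     F \<in> extensional (- \<real>\<^sub>\<le>\<^sub>0) \<and>
     b \<ge> 0 \<and>
     finite_measure \<rho> \<and> sets \<rho> = sets borel \<and> emeasure \<rho> {..<0} = 0 \<and>
     (\<forall>z \<in> - \<real>\<^sub>\<le>\<^sub>0. F z = of_real a + of_real b * z +
        (LINT x:{0..}|\<rho>. (z * of_real x - 1) / (z + of_real x)))"

definition Nevanlinna_Pick :: "(complex \<Rightarrow> complex) set" where
  "Nevanlinna_Pick = {F. \<exists>a b \<rho>. NP_characteristics F a b \<rho>}"

definition Nevanlinna_Pick_star :: "(complex \<Rightarrow> complex) set" where
  "Nevanlinna_Pick_star =
     {F. \<exists>a b \<rho>. NP_characteristics F a b \<rho> \<and>
           ((\<lambda>z. F z / z) \<longlongrightarrow> of_real b) (inf at_infinity (principal C_plus)) \<and> b = 0}"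

definition LE_characteristics ::
  "(real \<Rightarrow> real) \<Rightarrow> real \<Rightarrow> real \<Rightarrow> real \<Rightarrow> real measure \<Rightarrow> bool" where
  "LE_characteristics \<Psi> \<alpha> \<beta> \<gamma> \<nu> \<longleftrightarrow>
     \<Psi> \<in> extensional {0..} \<and>
     \<alpha> \<ge> 0 \<and> \<gamma> \<ge> 0 \<and>
     sets \<nu> = sets borel \<and> emeasure \<nu> {..0} = 0 \<and>
     (\<integral>\<^sup>+ x. ennreal (min (x\<^sup>2) 1) \<partial>\<nu>) < \<infinity> \<and>
     (\<forall>t\<ge>0. \<Psi> t = \<alpha> + \<beta> * t + \<gamma>\<^sup>2 / 2 * t\<^sup>2 +
        (LINT x:{0<..}|\<nu>. exp (- t * x) - 1 + t * (x / (1 + x\<^sup>2))))"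

definition Levy_Laplace :: "(real \<Rightarrow> real) set" where
  "Levy_Laplace = {\<Psi>. \<exists>\<alpha> \<beta> \<gamma> \<nu>. LE_characteristics \<Psi> \<alpha> \<beta> \<gamma> \<nu>}"

definition Theta_integrand :: "real \<Rightarrow> (real \<Rightarrow> real) \<Rightarrow> complex \<Rightarrow> real \<Rightarrow> complex" where
  "Theta_integrand b \<Psi> z u = exp (- z * of_real u) * of_real (b + \<Psi> 0 - \<Psi> u)"

text \<open>
  The integral formula is meaningful on \<open>C_plus\<close> only, while members of \<open>Nevanlinna_Pick\<close> live on
  the slit plane; hence \<open>Theta b \<Psi>\<close> is the member that is given by the formula on \<open>C_plus\<close>.
\<close>

definition Theta :: "real \<Rightarrow> (real \<Rightarrow> real) \<Rightarrow> complex \<Rightarrow> complex" where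
  "Theta b \<Psi> = (THE F. F \<in> Nevanlinna_Pick \<and>
     (\<forall>z \<in> C_plus. F z = z\<^sup>2 * (LINT u:{0..}|lborel. Theta_integrand b \<Psi> z u)))"

text \<open>
  The measure \<open>\<gamma>\<^sup>2 \<delta>\<^sub>0(dx) + x\<^sup>2 / (1 + x\<^sup>2) \<nu>(dx)\<close>, where \<open>return borel 0\<close> is the Dirac mass at 0.
\<close>

definition Theta_measure :: "real \<Rightarrow> real measure \<Rightarrow> real measure" where
  "Theta_measure \<gamma> \<nu> = measure_of UNIV (sets borel)
     (\<lambda>A. emeasure (scale_measure (ennreal (\<gamma>\<^sup>2)) (return borel 0)) A +
          emeasure (density \<nu> (\<lambda>x. ennreal (x\<^sup>2 / (1 + x\<^sup>2)))) A)"

end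

theory Submission
  imports Defs "HOL-Real_Asymp.Real_Asymp"
begin

text \<open>
  The heart of the matter is a Fubini argument with one kernel. For a Levy-Laplace exponent with
  characteristics \<open>(\<alpha>, \<beta>, \<gamma>, \<nu>)\<close> let \<open>\<rho> = \<gamma>\<^sup>2 \<delta>\<^sub>0 + x\<^sup>2 / (1 + x\<^sup>2) \<nu>\<close>. Dividing the integrand
  \<open>e\<^bsup>-ux\<^esup> - 1 + u x / (1 + x\<^sup>2)\<close> of \<open>\<nu>\<close> by the density \<open>x\<^sup>2 / (1 + x\<^sup>2)\<close> gives a kernel \<open>K(u, x)\<close> that
  extends continuously by \<open>K(u, 0) = u\<^sup>2 / 2\<close> to \<open>x = 0\<close>. Hence the Gaussian part is simply the mass of
  \<open>\<rho>\<close> at the origin, and \<open>\<Psi>(u) = \<alpha> + \<beta> u + \<integral> K(u, x) \<rho>(dx)\<close> with a finite measure \<open>\<rho>\<close> and a kernel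
  bounded by \<open>2 (1 + u + u\<^sup>2)\<close>. The Laplace transform of \<open>K(\<sqdot>, x)\<close> at \<open>z\<close> is
  \<open>- (z x - 1) / (z\<^sup>2 (z + x))\<close>, so that interchanging the integrals turns
  \<open>z\<^sup>2 \<integral> e\<^bsup>-zu\<^esup> (b + \<Psi>(0) - \<Psi>(u)) du\<close> into the Nevanlinna-Pick form with characteristics
  \<open>(-\<beta>, b, \<rho>)\<close> (lemma \<open>Theta_integrand_Laplace\<close>).

  Uniqueness rests on the fact that \<open>(a, b, \<rho>)\<close> can be recovered from \<open>F\<close> on \<open>(0, \<infinity>)\<close> alone
  (lemma \<open>NP_characteristics_unique\<close>). Since the characteristics give \<open>F\<close> on the whole slit plane,
  two functions of the class that agree on \<open>(0, \<infinity>)\<close> are equal. In the coordinate \<open>y = 1 / (1 + x) \<in> [0, 1]\<close>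
  the coefficients of the power series of \<open>F(1 + w) - F(1)\<close> in \<open>w\<close> are, up to sign, the moments of one
  finite measure on \<open>[0, 1]\<close>: the image of \<open>(1 + x\<^sup>2) / (1 + x)\<^sup>2 \<rho>\<close> plus the mass \<open>b\<close> at \<open>y = 0\<close>, the
  point that corresponds to \<open>x = \<infinity>\<close>. By the Weierstrass theorem these moments determine the measure,
  and therefore \<open>b\<close> and \<open>\<rho>\<close>.

  For the last claim, \<open>\<rho> \<mapsto> (\<gamma>, \<nu>)\<close> is inverted explicitly (lemma \<open>obtain_Levy_measure\<close>), so every
  Nevanlinna-Pick function with \<open>b = 0\<close> is the image of some \<open>(0, \<Psi>)\<close>; conversely \<open>b = 0\<close> forces
  \<open>F(z) / z\<close> to vanish at infinity, by dominated convergence (lemma \<open>NP_quotient_tendsto_0\<close>).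
\<close>

section \<open>The compensated exponential kernel and its Laplace transform\<close>

text \<open>
  The integrand of the Levy-Khintchine formula relative to \<open>x\<^sup>2 / (1 + x\<^sup>2) \<nu>(dx)\<close> instead of \<open>\<nu>(dx)\<close>.
  The value at \<open>x = 0\<close> is the limit for \<open>x \<rightarrow> 0\<close>; it accounts for the Gaussian term
  \<open>\<gamma>\<^sup>2 u\<^sup>2 / 2\<close>.
\<close>

definition compensated_kernel :: "real \<Rightarrow> real \<Rightarrow> real" where
  "compensated_kernel u x = (if x = 0 then u\<^sup>2 / 2
     else (1 + x\<^sup>2) / x\<^sup>2 * (exp (- u * x) - 1 + u * (x / (1 + x\<^sup>2))))"

text \<open>
  For \<open>x \<le> 1\<close> the compensator agrees with \<open>u x\<close> up to \<open>u x\<^sup>3 / (1 + x\<^sup>2) \<le> u x\<^sup>2\<close>, and the second order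
  Taylor remainder of the exponential is of size \<open>(u x)\<^sup>2\<close>. For \<open>x > 1\<close> each of the terms is bounded
  separately.
\<close>

lemma compensated_exp_bound:
  fixes u x :: real
  assumes "u \<ge> 0" "x > 0"
  shows "\<bar>exp (- u * x) - 1 + u * (x / (1 + x\<^sup>2))\<bar> \<le> (1 + u + u\<^sup>2) * min (x\<^sup>2) 1"
proof (cases "x \<le> 1")
  case True
  have s: "0 \<le> u * x" using assms by simp
  have low: "1 - u * x \<le> exp (- (u * x))"
    using exp_ge_add_one_self[of "- (u * x)"] by simp
  \<comment> \<open>Compare with \<open>1 / (1 + s)\<close> for \<open>s = u x \<le> 1\<close>; for larger \<open>s\<close> the right-hand side exceeds \<open>1\<close>.\<close>
  have up: "exp (- (u * x)) \<le> 1 - u * x + (u * x)\<^sup>2"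
  proof (cases "u * x \<le> 1")
    case True
    have "exp (- (u * x)) \<le> inverse (1 + u * x)"
      using exp_ge_add_one_self[of "u * x"] s
      by (simp add: exp_minus le_imp_inverse_le)
    also have "\<dots> \<le> 1 - u * x + (u * x)\<^sup>2"
    proof -
      have "1 \<le> (1 - u * x + (u * x)\<^sup>2) * (1 + u * x)"
      proof -
        have "(1 - u * x + (u * x)\<^sup>2) * (1 + u * x) = 1 + (u * x) ^ 3"
          by (simp add: algebra_simps power2_eq_square power3_eq_cube)
        then show ?thesis using s by simp
      qed
      then show ?thesis using s by (simp add: inverse_eq_divide divide_le_eq)
    qed
    finally show ?thesis .
  next
    case False
    then have "exp (- (u * x)) \<le> 1" "u * x \<le> (u * x)\<^sup>2"
      using s mult_left_mono[of 1 "u * x" "u * x"] by (auto simp: power2_eq_square)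
    then show ?thesis by linarith
  qed
  have split: "u * (x / (1 + x\<^sup>2)) = u * x - u * (x ^ 3 / (1 + x\<^sup>2))"
    using sum_power2_gt_zero_iff[of 1 x]
    by (simp add: field_simps power2_eq_square power3_eq_cube add_nonneg_eq_0_iff)
  have "x ^ 3 / (1 + x\<^sup>2) \<le> x\<^sup>2"
  proof -
    have "x ^ 3 \<le> x\<^sup>2 * (1 + x\<^sup>2)"
    proof -
      have "x \<le> 1 + x\<^sup>2" using True zero_le_power2[of x] by linarith
      then show ?thesis
        using mult_left_mono[of x "1 + x\<^sup>2" "x\<^sup>2"] by (simp add: power3_eq_cube power2_eq_square mult.assoc)
    qed
    then show ?thesis by (simp add: divide_le_eq add_pos_nonneg)
  qed
  then have c: "0 \<le> u * (x ^ 3 / (1 + x\<^sup>2))" "u * (x ^ 3 / (1 + x\<^sup>2)) \<le> u * x\<^sup>2"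
    using assms mult_left_mono[of "x ^ 3 / (1 + x\<^sup>2)" "x\<^sup>2" u] by auto
  have "\<bar>exp (- (u * x)) - 1 + u * (x / (1 + x\<^sup>2))\<bar> \<le> (u * x)\<^sup>2 + u * x\<^sup>2"
    unfolding split using low up c by (smt (verit) zero_le_power2)
  also have "\<dots> \<le> (1 + u + u\<^sup>2) * x\<^sup>2"
    by (simp add: algebra_simps power_mult_distrib)
  finally show ?thesis using True assms by (simp add: min_def power_le_one_iff abs_le_square_iff power2_eq_square mult_le_one)
next
  case False
  have "0 \<le> exp (- u * x)" "exp (- u * x) \<le> 1" using assms by auto
  moreover have "0 \<le> x / (1 + x\<^sup>2)" "x / (1 + x\<^sup>2) \<le> 1"
    using assms False self_le_power[of x 2] by (auto simp: divide_le_eq add_pos_nonneg)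
  then have "0 \<le> u * (x / (1 + x\<^sup>2))" "u * (x / (1 + x\<^sup>2)) \<le> u"
    using assms mult_left_mono[of "x / (1 + x\<^sup>2)" 1 u] by auto
  ultimately have "\<bar>exp (- u * x) - 1 + u * (x / (1 + x\<^sup>2))\<bar> \<le> 1 + u + u\<^sup>2"
    by (smt (verit) zero_le_power2)
  moreover have "min (x\<^sup>2) 1 = 1" using False one_le_power[of x 2] by linarith
  ultimately show ?thesis by simp
qed

lemma compensated_kernel_bound:
  assumes "u \<ge> 0" "x \<ge> 0"
  shows "\<bar>compensated_kernel u x\<bar> \<le> 2 * (1 + u + u\<^sup>2)"
proof (cases "x = 0")
  case True
  then show ?thesis using assms zero_le_power2[of u] by (simp add: compensated_kernel_def)
next
  case False
  have "(1 + x\<^sup>2) / x\<^sup>2 * min (x\<^sup>2) 1 \<le> 2"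
    using False by (cases "x\<^sup>2 \<le> 1") (simp_all add: min_def divide_le_eq)
  then have m: "(1 + x\<^sup>2) / x\<^sup>2 * min (x\<^sup>2) 1 * (1 + u + u\<^sup>2) \<le> 2 * (1 + u + u\<^sup>2)"
    using assms by (intro mult_right_mono) auto
  have "\<bar>compensated_kernel u x\<bar> = (1 + x\<^sup>2) / x\<^sup>2 * \<bar>exp (- u * x) - 1 + u * (x / (1 + x\<^sup>2))\<bar>"
    using False by (simp add: compensated_kernel_def abs_mult)
  also have "\<dots> \<le> (1 + x\<^sup>2) / x\<^sup>2 * ((1 + u + u\<^sup>2) * min (x\<^sup>2) 1)"
    using compensated_exp_bound[of u x] assms False by (intro mult_left_mono) auto
  finally show ?thesis using m by (simp add: mult_ac)
qed

lemma borel_measurable_compensated_kernel [measurable]: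
  "(\<lambda>(u, x). compensated_kernel u x) \<in> borel_measurable (borel \<Otimes>\<^sub>M borel)"
  unfolding compensated_kernel_def by measurable

text \<open>
  Up to a constant factor, the function that dominates \<open>e\<^bsup>-zu\<^esup> K(u, x)\<close> uniformly in \<open>x\<close>, with \<open>r = Re z\<close>.
\<close>

lemma integrable_quadratic_exp:
  fixes r :: real
  assumes r: "r > 0"
  shows "set_integrable lborel {0..} (\<lambda>u. exp (- r * u) * (1 + u + u\<^sup>2))"
proof -
  let ?f = "\<lambda>u. exp (- r * u) * (1 + u + u\<^sup>2)"
  \<comment> \<open>The antiderivative that vanishes at infinity, found by integrating by parts twice.\<close>
  let ?F = "\<lambda>u. - exp (- r * u) * (u\<^sup>2 / r + (1 / r + 2 / r\<^sup>2) * u + (1 / r + 1 / r\<^sup>2 + 2 / r ^ 3))"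
  have "(\<integral>\<^sup>+u. ennreal (?f u) * indicator {0..} u \<partial>lborel) = 0 - ?F 0"
  proof (rule nn_integral_FTC_atLeast)
    show "(?F has_real_derivative ?f u) (at u)" if "0 \<le> u" for u
      using r by (auto intro!: derivative_eq_intros simp: field_simps power2_eq_square power3_eq_cube)
    show "(?F \<longlongrightarrow> 0) at_top" using r by real_asymp
    show "0 \<le> ?f u" if "0 \<le> u" for u using that by simp
  qed auto
  moreover have "(\<integral>\<^sup>+u. ennreal (norm (indicator {0..} u *\<^sub>R ?f u)) \<partial>lborel)
      = (\<integral>\<^sup>+u. ennreal (?f u) * indicator {0..} u \<partial>lborel)"
    by (intro nn_integral_cong) (auto simp: indicator_def)
  ultimately show ?thesis
    unfolding set_integrable_def by (intro integrableI_bounded) auto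
qed

text \<open>
  Powers up to two suffice: besides exponentials, only the compensator \<open>u x / (1 + x\<^sup>2)\<close> and the value
  \<open>u\<^sup>2 / 2\<close> at \<open>x = 0\<close> enter the kernel.
\<close>

lemma Laplace_power:
  fixes z :: complex
  assumes z: "Re z > 0" and n: "n \<le> 2"
  shows "set_integrable lborel {0..} (\<lambda>u. exp (- z * of_real u) * of_real u ^ n)"
    and "(LINT u:{0..}|lborel. exp (- z * of_real u) * of_real u ^ n) = fact n / z ^ Suc n"
proof -
  let ?f = "\<lambda>u. exp (- z * of_real u) * of_real u ^ n"
  show int: "set_integrable lborel {0..} ?f"
  proof (rule set_integrable_bound[OF integrable_quadratic_exp[OF z]])
    show "set_borel_measurable lborel {0..} ?f"
      unfolding set_borel_measurable_def by measurable
    have "u ^ n \<le> 1 + u + u\<^sup>2" if "u \<ge> 0" for u :: real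
    proof -
      consider "n = 0" | "n = 1" | "n = 2" using n by linarith
      then show ?thesis using that by cases auto
    qed
    then show "AE u in lborel. u \<in> {0..} \<longrightarrow> norm (?f u) \<le> norm (exp (- Re z * u) * (1 + u + u\<^sup>2))"
      by (intro AE_I2) (auto simp: norm_mult norm_power)
  qed
  have z0: "z \<noteq> 0" using z by auto
  \<comment> \<open>An antiderivative of \<open>e\<^bsup>-zu\<^esup> u\<^sup>n\<close>, so that the integral equals \<open>- F 0\<close>.\<close>
  define F where "F = (\<lambda>u::real. - exp (- z * of_real u) *
    (if n = 0 then 1 / z else if n = 1 then of_real u / z + 1 / z\<^sup>2
     else of_real u ^ 2 / z + 2 * of_real u / z\<^sup>2 + 2 / z ^ 3))"
  have cases: "n = 0 \<or> n = 1 \<or> n = 2" using n by linarith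
  have "(LBINT u=ereal 0..\<infinity>. ?f u) = 0 - F 0"
  proof (rule interval_integral_FTC_integrable)
    show "(F has_vector_derivative ?f u) (at u)" for u
    proof -
      have "((\<lambda>w. - exp (- z * w) *
          (if n = 0 then 1 / z else if n = 1 then w / z + 1 / z\<^sup>2
           else w ^ 2 / z + 2 * w / z\<^sup>2 + 2 / z ^ 3)) has_field_derivative
           exp (- z * of_real u) * of_real u ^ n) (at (of_real u))"
        using cases
        by (elim disjE) (auto intro!: derivative_eq_intros simp: z0 field_simps power2_eq_square power3_eq_cube)
      then show ?thesis
        unfolding F_def using has_vector_derivative_real_field by fastforce
    qed
    show "isCont ?f u" for u by (intro continuous_intros)
    show "set_integrable lborel (einterval (ereal 0) \<infinity>) ?f"
      using int by (rule set_integrable_subset) auto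
    have "isCont F 0" unfolding F_def using cases by (elim disjE) (auto intro!: continuous_intros simp: z0)
    then have "(F \<longlongrightarrow> F 0) (at_right 0)"
      using continuous_at_imp_continuous_at_within continuous_within by blast
    then show "((F \<circ> real_of_ereal) \<longlongrightarrow> F 0) (at_right (ereal 0))"
      by (simp add: ereal_tendsto_simps)
    have decay: "((\<lambda>u::real. exp (- z * of_real u) * of_real u ^ k) \<longlongrightarrow> 0) at_top" if "k \<le> 2" for k
    proof (rule tendsto_norm_zero_cancel)
      have "((\<lambda>u. exp (- Re z * u) * \<bar>u\<bar> ^ k) \<longlongrightarrow> 0) at_top"
      proof -
        consider "k = 0" | "k = 1" | "k = 2" using \<open>k \<le> 2\<close> by linarith
        then show ?thesis using z by cases (simp_all, real_asymp+)
      qed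
      then show "((\<lambda>u::real. norm (exp (- z * of_real u) * of_real u ^ k)) \<longlongrightarrow> 0) at_top"
        by (simp add: norm_mult norm_power)
    qed
    have "(F \<longlongrightarrow> 0) at_top"
    proof -
      have "((\<lambda>u::real. - (c0 * (exp (- z * of_real u) * of_real u ^ 0) + c1 * (exp (- z * of_real u) * of_real u ^ 1)
          + c2 * (exp (- z * of_real u) * of_real u ^ 2))) \<longlongrightarrow> - (c0 * 0 + c1 * 0 + c2 * 0)) at_top" for c0 c1 c2
        by (intro tendsto_intros decay) auto
      from this[of "if n = 0 then 1 / z else if n = 1 then 1 / z\<^sup>2 else 2 / z ^ 3"
          "if n = 0 then 0 else if n = 1 then 1 / z else 2 / z\<^sup>2"
          "if n = 2 then 1 / z else 0"]
      show ?thesis using cases unfolding F_def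
        by (elim disjE) (simp_all add: algebra_simps)
    qed
    then show "((F \<circ> real_of_ereal) \<longlongrightarrow> 0) (at_left \<infinity>)"
      by (simp add: ereal_tendsto_simps)
  qed auto
  moreover have "(LINT u:{0..}|lborel. ?f u) = (LBINT u=ereal 0..\<infinity>. ?f u)"
    unfolding interval_integral_to_infinity_eq set_lebesgue_integral_def
    by (intro integral_cong_AE)
      (use AE_lborel_singleton[of 0] in \<open>auto elim!: eventually_mono simp: indicator_def\<close>)
  ultimately show "(LINT u:{0..}|lborel. ?f u) = fact n / z ^ Suc n"
    using cases by (auto simp: F_def power2_eq_square power3_eq_cube)
qed

text \<open>
  With \<open>c = (1 + x\<^sup>2) / x\<^sup>2\<close> and \<open>d = x / (1 + x\<^sup>2)\<close>, the Laplace transform for \<open>x > 0\<close> is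
  \<open>c (1 / (z + x) - 1 / z + d / z\<^sup>2)\<close>, and the singular factor \<open>1 / x\<^sup>2\<close> cancels. That the result at
  \<open>x = 0\<close> is given by the same formula is what makes the value \<open>K(u, 0) = u\<^sup>2 / 2\<close> the right one.
\<close>

lemma Laplace_compensated_kernel:
  fixes z :: complex
  assumes z: "Re z > 0" and x: "x \<ge> 0"
  shows "z\<^sup>2 * (LINT u:{0..}|lborel. exp (- z * of_real u) * of_real (compensated_kernel u x))
    = - ((z * of_real x - 1) / (z + of_real x))"
proof (cases "x = 0")
  case True
  have z0: "z \<noteq> 0" using z by auto
  have "(\<lambda>u. exp (- z * of_real u) * of_real (compensated_kernel u x))
      = (\<lambda>u. (exp (- z * of_real u) * of_real u ^ 2) * (1 / 2 :: complex))"
    using True by (simp add: compensated_kernel_def)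
  then show ?thesis
    using Laplace_power(2)[OF z, of 2] z0 True
    by (simp add: set_integral_mult_left power2_eq_square power3_eq_cube field_simps)
next
  case False
  have z0: "z \<noteq> 0" using z by auto
  have zx: "Re (z + of_real x) > 0" using z x by simp
  have zx0: "z + of_real x \<noteq> 0" using zx by (metis less_irrefl zero_complex.sel(1))
  have x20: "1 + (of_real x)\<^sup>2 \<noteq> (0::complex)"
  proof -
    have "1 + x\<^sup>2 \<noteq> 0" by (simp add: add_nonneg_eq_0_iff)
    then have "complex_of_real (1 + x\<^sup>2) \<noteq> 0" by (simp only: of_real_eq_0_iff not_False_eq_True)
    then show ?thesis by (metis of_real_add of_real_power of_real_1)
  qed
  define c where "c = complex_of_real ((1 + x\<^sup>2) / x\<^sup>2)"
  define d where "d = complex_of_real (x / (1 + x\<^sup>2))"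
  let ?shifted = "\<lambda>u. exp (- (z + of_real x) * of_real u) * of_real u ^ 0 :: complex"
  let ?const = "\<lambda>u. exp (- z * of_real u) * of_real u ^ 0 :: complex"
  let ?linear = "\<lambda>u. exp (- z * of_real u) * of_real u ^ 1 :: complex"
  note i = Laplace_power(1)[OF zx, of 0] Laplace_power(1)[OF z, of 0] Laplace_power(1)[OF z, of 1]
  have "exp (- z * of_real u) * of_real (compensated_kernel u x)
      = c * (?shifted u - ?const u + d * ?linear u)" for u
  proof -
    have "exp (- (z + of_real x) * of_real u) = exp (- z * of_real u) * of_real (exp (- u * x))"
      by (simp add: algebra_simps exp_diff exp_minus divide_inverse flip: exp_of_real)
    then show ?thesis
      using False by (simp add: compensated_kernel_def c_def d_def algebra_simps)
  qed
  then have "(LINT u:{0..}|lborel. exp (- z * of_real u) * of_real (compensated_kernel u x))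
      = (LINT u:{0..}|lborel. c * (?shifted u - ?const u + d * ?linear u))" by simp
  also have "\<dots> = c * (fact 0 / (z + of_real x) ^ Suc 0 - fact 0 / z ^ Suc 0 + d * (fact 1 / z ^ Suc 1))"
  proof -
    have "(LINT u:{0..}|lborel. c * (?shifted u - ?const u + d * ?linear u))
        = c * ((LINT u:{0..}|lborel. ?shifted u) - (LINT u:{0..}|lborel. ?const u)
          + d * (LINT u:{0..}|lborel. ?linear u))"
      using set_integral_add(2)[OF set_integral_diff(1)[OF i(1,2)] set_integrable_mult_right[OF i(3), of d]]
        set_integral_diff(2)[OF i(1,2)]
      by (simp only: set_integral_mult_right)
    then show ?thesis
      using Laplace_power(2)[OF zx, of 0] Laplace_power(2)[OF z, of 0] Laplace_power(2)[OF z, of 1]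
      by (simp only: zero_le_numeral one_le_numeral)
  qed
  also have "z\<^sup>2 * \<dots> = - ((z * of_real x - 1) / (z + of_real x))"
    using z0 zx0 x20 False unfolding c_def d_def
    by (simp add: divide_simps) (simp add: algebra_simps power2_eq_square)
  finally show ?thesis .
qed

section \<open>Finite measures on the half-line\<close>

locale half_line_measure = finite_measure \<rho> for \<rho> :: "real measure" +
  assumes sets_eq [measurable_cong]: "sets \<rho> = sets borel"
    and neg_null: "emeasure \<rho> {..<0} = 0"
begin

lemma space_eq [simp]: "space \<rho> = UNIV"
  using sets_eq_imp_space_eq[OF sets_eq] by simp

lemma AE_nonneg: "AE x in \<rho>. 0 \<le> x"
  by (rule AE_I[where N = "{..<0}"]) (use neg_null sets_eq in auto)

text \<open>
  Lets all later arguments use integrals over the whole line, in place of the set integrals over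
  \<open>[0, \<infinity>)\<close> that occur in the definition of the characteristics.
\<close>

lemma set_integral_half_line:
  fixes f :: "real \<Rightarrow> 'a :: {banach, second_countable_topology}"
  assumes [measurable]: "f \<in> borel_measurable borel"
  shows "(LINT x:{0..}|\<rho>. f x) = (LINT x|\<rho>. f x)"
  unfolding set_lebesgue_integral_def
  by (intro integral_cong_AE) (use AE_nonneg in \<open>auto elim!: eventually_mono\<close>)

lemma integrable_bounded_half_line:
  fixes f :: "real \<Rightarrow> 'a :: {banach, second_countable_topology}"
  assumes [measurable]: "f \<in> borel_measurable borel"
    and "\<And>x. x \<ge> 0 \<Longrightarrow> norm (f x) \<le> B"
  shows "integrable \<rho> f"
  by (rule integrable_const_bound[where B = B])
    (use AE_nonneg assms in \<open>auto elim!: eventually_mono\<close>)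

text \<open>
  Fubini's theorem applied to \<open>du \<otimes> \<rho>(dx)\<close>: since \<open>\<rho>\<close> is finite and the kernel grows at most
  quadratically in \<open>u\<close>, uniformly in \<open>x\<close>, the factor \<open>e\<^bsup>-zu\<^esup>\<close> makes the product integrable.
\<close>

lemma Laplace_compensated_integral:
  fixes z :: complex
  assumes z: "Re z > 0"
  defines "g \<equiv> \<lambda>u. LINT x|\<rho>. compensated_kernel u x"
  shows "set_integrable lborel {0..} (\<lambda>u. exp (- z * of_real u) * of_real (g u))"
    and "z\<^sup>2 * (LINT u:{0..}|lborel. exp (- z * of_real u) * of_real (g u))
      = - (LINT x|\<rho>. (z * of_real x - 1) / (z + of_real x))"
proof -
  interpret P: pair_sigma_finite lborel \<rho> ..
  define G :: "real \<Rightarrow> real \<Rightarrow> complex" where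
    "G u x = indicator {0..} u *\<^sub>R (exp (- z * of_real u) * of_real (compensated_kernel u x))" for u x
  have G_meas [measurable]: "case_prod G \<in> borel_measurable (lborel \<Otimes>\<^sub>M \<rho>)"
    unfolding G_def by measurable
  define h :: "real \<Rightarrow> real" where
    "h u = indicator {0..} u * (exp (- Re z * u) * (1 + u + u\<^sup>2)) * 2" for u
  have h_int: "integrable lborel h"
    unfolding h_def using integrable_quadratic_exp[OF z]
    by (auto simp: set_integrable_def)
  have G_bound: "norm (G u x) \<le> h u" if "x \<ge> 0" for u x
    using compensated_kernel_bound[of u x] that
    by (auto simp: G_def h_def norm_mult indicator_def)
  have G_int: "integrable \<rho> (G u)" for u
    using G_bound by (intro integrable_bounded_half_line[of _ "h u"]) (auto simp: G_def)
  have "integrable (lborel \<Otimes>\<^sub>M \<rho>) (case_prod G)"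
  proof (rule P.Fubini_integrable)
    show "integrable lborel (\<lambda>u. LINT x|\<rho>. norm (case_prod G (u, x)))"
    proof (rule Bochner_Integration.integrable_bound)
      show "integrable lborel (\<lambda>u. h u * measure \<rho> UNIV)" using h_int by simp
      have "(LINT x|\<rho>. norm (G u x)) \<le> (LINT x|\<rho>. h u)" for u
        using G_int[of u] G_bound AE_nonneg by (intro integral_mono_AE) (auto elim!: eventually_mono)
      then show "AE u in lborel. norm (LINT x|\<rho>. norm (case_prod G (u, x))) \<le> norm (h u * measure \<rho> UNIV)"
        by (intro AE_I2) (auto simp: mult.commute intro: order_trans[OF _ abs_ge_self])
    qed measurable
    show "AE u in lborel. integrable \<rho> (\<lambda>x. case_prod G (u, x))" using G_int by simp
  qed measurable
  note Fubini = P.Fubini_integral[OF this] P.integrable_fst[OF this]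
  have inner: "(LINT x|\<rho>. G u x) = indicator {0..} u *\<^sub>R (exp (- z * of_real u) * of_real (g u))" for u
    unfolding G_def g_def by simp
  show "set_integrable lborel {0..} (\<lambda>u. exp (- z * of_real u) * of_real (g u))"
    using Fubini(2) unfolding set_integrable_def inner .
  have "(LINT u:{0..}|lborel. exp (- z * of_real u) * of_real (g u)) = (LINT u|lborel. LINT x|\<rho>. G u x)"
    unfolding inner set_lebesgue_integral_def ..
  also have "z\<^sup>2 * \<dots> = (LINT x|\<rho>. z\<^sup>2 * (LINT u|lborel. G u x))"
    unfolding Fubini(1)[symmetric] by simp
  also have "\<dots> = (LINT x|\<rho>. - ((z * of_real x - 1) / (z + of_real x)))"
  proof (rule integral_cong_AE)
    show "AE x in \<rho>. z\<^sup>2 * (LINT u|lborel. G u x) = - ((z * of_real x - 1) / (z + of_real x))"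
      using AE_nonneg
    proof eventually_elim
      case (elim x)
      show ?case
        using Laplace_compensated_kernel[OF z elim] unfolding G_def set_lebesgue_integral_def .
    qed
  qed measurable
  finally show "z\<^sup>2 * (LINT u:{0..}|lborel. exp (- z * of_real u) * of_real (g u))
      = - (LINT x|\<rho>. (z * of_real x - 1) / (z + of_real x))" by simp
qed

end

section \<open>The characteristics of a Nevanlinna-Pick function are unique\<close>

text \<open>
  The map \<open>x \<mapsto> y = 1 / (1 + x)\<close> takes \<open>[0, \<infinity>]\<close> to \<open>[0, 1]\<close>. In this coordinate the increment of
  \<open>(t x - 1) / (t + x)\<close> from \<open>t = 1\<close> to \<open>t = 1 + w\<close> is \<open>w c(x) / (1 + w y)\<close> with this weight \<open>c\<close>.
\<close>

definition moebius_weight :: "real \<Rightarrow> real" where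
  "moebius_weight x = (1 + x\<^sup>2) / (1 + x)\<^sup>2"

lemma borel_measurable_moebius_weight [measurable]: "moebius_weight \<in> borel_measurable borel"
  unfolding moebius_weight_def by measurable

lemma moebius_weight_nonneg: "0 \<le> moebius_weight x"
  by (simp add: moebius_weight_def)

lemma moebius_weight_pos: "0 \<le> x \<Longrightarrow> 0 < moebius_weight x"
  by (simp add: moebius_weight_def add_pos_nonneg)

lemma moebius_weight_le_1:
  assumes "0 \<le> x"
  shows "moebius_weight x \<le> 1"
proof -
  have "1 + x\<^sup>2 \<le> (1 + x)\<^sup>2" "0 < (1 + x)\<^sup>2" using assms by (simp add: power2_sum, simp)
  then show ?thesis by (simp only: moebius_weight_def divide_le_eq_1_pos)
qed

text \<open>
  The integral of \<open>f\<close> against the finite measure on \<open>[0, 1]\<close> that consists of the mass \<open>b\<close> at \<open>y = 0\<close>,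
  which is the image of \<open>x = \<infinity>\<close>, and of the image of the weighted measure \<open>c \<rho>\<close>. It puts \<open>b\<close> and
  \<open>\<rho>\<close> on the same footing.
\<close>

definition moebius_integral :: "real \<Rightarrow> real measure \<Rightarrow> (real \<Rightarrow> real) \<Rightarrow> real" where
  "moebius_integral b \<rho> f = b * f 0 + (LINT x|\<rho>. moebius_weight x * f (1 / (1 + x)))"

context half_line_measure
begin

lemma integrable_moebius:
  assumes [measurable]: "f \<in> borel_measurable borel"
    and "\<And>y. y \<in> {0..1} \<Longrightarrow> \<bar>f y\<bar> \<le> B"
  shows "integrable \<rho> (\<lambda>x. moebius_weight x * f (1 / (1 + x)))"
proof (rule integrable_bounded_half_line[where B = "1 * B"])
  show "norm (moebius_weight x * f (1 / (1 + x))) \<le> 1 * B" if "x \<ge> 0" for x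
    unfolding norm_mult
    using that assms(2) moebius_weight_le_1[OF that] moebius_weight_nonneg[of x]
    by (intro mult_mono) auto
qed measurable

lemma moebius_integral_bound:
  assumes [measurable]: "f \<in> borel_measurable borel" and b: "b \<ge> 0"
    and B: "\<And>y. y \<in> {0..1} \<Longrightarrow> \<bar>f y\<bar> \<le> B"
  shows "\<bar>moebius_integral b \<rho> f\<bar> \<le> B * (b + measure \<rho> UNIV)"
proof -
  have "\<bar>LINT x|\<rho>. moebius_weight x * f (1 / (1 + x))\<bar> \<le> (LINT x|\<rho>. B)"
  proof (rule order_trans[OF integral_abs_bound], rule integral_mono_AE)
    show "AE x in \<rho>. \<bar>moebius_weight x * f (1 / (1 + x))\<bar> \<le> B"
      using AE_nonneg
    proof eventually_elim
      case (elim x)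
      then have "\<bar>moebius_weight x * f (1 / (1 + x))\<bar> \<le> 1 * B"
        unfolding abs_mult
        using B moebius_weight_le_1[OF elim] moebius_weight_nonneg[of x]
        by (intro mult_mono) auto
      then show ?case by simp
    qed
  qed (use integrable_moebius[OF assms(1) B] in auto)
  moreover have "\<bar>b * f 0\<bar> \<le> b * B"
    using b B[of 0] by (auto simp: abs_mult intro!: mult_left_mono)
  ultimately show ?thesis
    unfolding moebius_integral_def by (simp add: algebra_simps)
qed

lemma moebius_integral_diff:
  assumes [measurable]: "f \<in> borel_measurable borel" "g \<in> borel_measurable borel"
    and "\<And>y. y \<in> {0..1} \<Longrightarrow> \<bar>f y\<bar> \<le> B" "\<And>y. y \<in> {0..1} \<Longrightarrow> \<bar>g y\<bar> \<le> B'"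
  shows "moebius_integral b \<rho> (\<lambda>y. f y - g y) = moebius_integral b \<rho> f - moebius_integral b \<rho> g"
  unfolding moebius_integral_def
  using integrable_moebius[OF assms(1,3)] integrable_moebius[OF assms(2,4)]
  by (simp add: algebra_simps)

lemma moebius_integral_polynomial:
  "moebius_integral b \<rho> (\<lambda>y. \<Sum>i\<le>n. q i * y ^ i) = (\<Sum>i\<le>n. q i * moebius_integral b \<rho> (\<lambda>y. y ^ i))"
proof -
  have "integrable \<rho> (\<lambda>x. moebius_weight x * (1 / (1 + x)) ^ i)" for i
    by (rule integrable_moebius[where B = 1]) (auto simp: power_le_one)
  then have i: "integrable \<rho> (\<lambda>x. q i * (moebius_weight x * (1 / (1 + x)) ^ i))" for i
    by simp
  have "(LINT x|\<rho>. moebius_weight x * (\<Sum>i\<le>n. q i * (1 / (1 + x)) ^ i))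
      = (LINT x|\<rho>. (\<Sum>i\<le>n. q i * (moebius_weight x * (1 / (1 + x)) ^ i)))"
    by (simp only: sum_distrib_left mult.left_commute)
  also have "\<dots> = (\<Sum>i\<le>n. (LINT x|\<rho>. q i * (moebius_weight x * (1 / (1 + x)) ^ i)))"
    using i by (rule Bochner_Integration.integral_sum)
  also have "\<dots> = (\<Sum>i\<le>n. q i * (LINT x|\<rho>. moebius_weight x * (1 / (1 + x)) ^ i))"
    by (simp only: integral_mult_right_zero)
  moreover have "b * (\<Sum>i\<le>n. q i * 0 ^ i) = (\<Sum>i\<le>n. q i * (b * 0 ^ i))"
    by (simp only: sum_distrib_left mult.left_commute)
  ultimately show ?thesis
    unfolding moebius_integral_def by (simp only: sum.distrib distrib_left)
qed

text \<open>
  The difference \<open>J(1 + w) - J(1)\<close> is \<open>w\<close> times the integral of \<open>1 / (1 + w y)\<close>. Expanding the latter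
  as a geometric series in \<open>-w y\<close>, with \<open>0 \<le> y \<le> 1\<close>, exhibits the moments as coefficients. The zeroth
  coefficient vanishes and the \<open>k\<close>-th moment belongs to \<open>w\<close> to the power \<open>k + 1\<close>.
\<close>

lemma Pick_power_series:
  fixes w b :: real
  assumes w: "\<bar>w\<bar> < 1"
  defines "J \<equiv> \<lambda>t. b * t + (LINT x|\<rho>. (t * x - 1) / (t + x))"
  shows "(\<lambda>n. (case n of 0 \<Rightarrow> 0 | Suc k \<Rightarrow> (- 1) ^ k * moebius_integral b \<rho> (\<lambda>y. y ^ k)) * w ^ n)
    sums (J (1 + w) - J 1)"
proof -
  have w': "- 1 < w" "w < 1" using w by auto
  let ?y = "\<lambda>x::real. 1 / (1 + x)"
  let ?term = "\<lambda>k x. moebius_weight x * (- w * ?y x) ^ k"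
  have term_eq: "?term k x = (- w) ^ k * (moebius_weight x * (?y x) ^ k)" for k x
    by (simp only: power_mult_distrib mult_ac)
  have int_pow: "integrable \<rho> (\<lambda>x. moebius_weight x * (?y x) ^ k)" for k
    by (rule integrable_moebius[where B = 1]) (auto simp: power_le_one)
  have term_bound: "\<bar>?term k x\<bar> \<le> \<bar>w\<bar> ^ k" if "x \<ge> 0" for k x
  proof -
    have "\<bar>moebius_weight x\<bar> \<le> 1" "\<bar>?y x\<bar> ^ k \<le> 1"
      using moebius_weight_le_1[OF that] moebius_weight_nonneg[of x] that by (auto intro!: power_le_one)
    then have "\<bar>moebius_weight x\<bar> * \<bar>?y x\<bar> ^ k \<le> 1 * 1"
      by (intro mult_mono) auto
    then have "\<bar>w\<bar> ^ k * (\<bar>moebius_weight x\<bar> * \<bar>?y x\<bar> ^ k) \<le> \<bar>w\<bar> ^ k * 1"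
      by (intro mult_left_mono) auto
    then show ?thesis unfolding term_eq abs_mult power_abs by simp
  qed
  have "(\<lambda>k. LINT x|\<rho>. ?term k x) sums (LINT x|\<rho>. (\<Sum>k. ?term k x))"
  proof (rule sums_integral)
    show "integrable \<rho> (?term k)" for k unfolding term_eq using int_pow by simp
    show "AE x in \<rho>. summable (\<lambda>k. norm (?term k x))"
      using AE_nonneg
    proof eventually_elim
      case (elim x)
      show ?case
        by (rule summable_comparison_test'[OF summable_geometric[of "\<bar>w\<bar>"]])
          (use w term_bound[OF elim] in auto)
    qed
    show "summable (\<lambda>k. LINT x|\<rho>. norm (?term k x))"
    proof (rule summable_comparison_test')
      show "summable (\<lambda>k. \<bar>w\<bar> ^ k * measure \<rho> UNIV)"
        using w by (intro summable_mult2 summable_geometric) auto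
      have "(LINT x|\<rho>. norm (?term k x)) \<le> (LINT x|\<rho>. \<bar>w\<bar> ^ k)" for k
      proof (rule integral_mono_AE)
        show "integrable \<rho> (\<lambda>x. norm (?term k x))"
          unfolding term_eq using int_pow by (intro integrable_norm) simp
        show "AE x in \<rho>. norm (?term k x) \<le> \<bar>w\<bar> ^ k"
          using AE_nonneg term_bound by (auto elim!: eventually_mono)
      qed simp
      then show "norm (LINT x|\<rho>. norm (?term k x)) \<le> \<bar>w\<bar> ^ k * measure \<rho> UNIV" if "0 \<le> k" for k
        by (simp add: mult.commute)
    qed
  qed
  also have "(LINT x|\<rho>. (\<Sum>k. ?term k x)) = (LINT x|\<rho>. moebius_weight x / (1 + w * ?y x))"
  proof (rule integral_cong_AE)
    show "AE x in \<rho>. (\<Sum>k. ?term k x) = moebius_weight x / (1 + w * ?y x)"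
      using AE_nonneg
    proof eventually_elim
      case (elim x)
      have "\<bar>?y x\<bar> \<le> 1" using elim by simp
      then have "\<bar>w\<bar> * \<bar>?y x\<bar> < 1" using w mult_left_le[of "\<bar>?y x\<bar>" "\<bar>w\<bar>"] by linarith
      then have "norm (- w * ?y x) < 1" by (simp add: abs_mult)
      from suminf_geometric[OF this] summable_geometric[OF this] show ?case
        by (subst suminf_mult) auto
    qed
  qed measurable
  finally have "(\<lambda>k. (- w) ^ k * (LINT x|\<rho>. moebius_weight x * (?y x) ^ k))
      sums (LINT x|\<rho>. moebius_weight x / (1 + w * ?y x))"
    unfolding term_eq by simp
  moreover have "(\<lambda>k. (- w) ^ k * (b * 0 ^ k)) sums b"
    using sums_mult[OF powser_sums_zero[of "\<lambda>k. (- w) ^ k"], of b] by (simp add: mult_ac)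
  ultimately have "(\<lambda>k. (- w) ^ k * (b * 0 ^ k) + (- w) ^ k * (LINT x|\<rho>. moebius_weight x * (?y x) ^ k))
      sums (b + (LINT x|\<rho>. moebius_weight x / (1 + w * ?y x)))"
    by (intro sums_add)
  then have "(\<lambda>k. (- w) ^ k * moebius_integral b \<rho> (\<lambda>y. y ^ k))
      sums (b + (LINT x|\<rho>. moebius_weight x / (1 + w * ?y x)))"
    unfolding moebius_integral_def by (simp only: distrib_left)
  from sums_mult[OF this, of w]
  have "(\<lambda>k. (- 1) ^ k * moebius_integral b \<rho> (\<lambda>y. y ^ k) * w ^ Suc k)
      sums (w * (b + (LINT x|\<rho>. moebius_weight x / (1 + w * ?y x))))"
    by (simp add: power_minus[of w] mult_ac)
  also have "w * (b + (LINT x|\<rho>. moebius_weight x / (1 + w * ?y x))) = J (1 + w) - J 1"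
  proof -
    have int: "integrable \<rho> (\<lambda>x. (t * x - 1) / (t + x))" if t: "t > 0" for t
    proof (rule integrable_bounded_half_line)
      show "norm ((t * x - 1) / (t + x)) \<le> t + 1 / t" if "x \<ge> 0" for x
      proof -
        have "\<bar>t * x - 1\<bar> \<le> t * x + 1" using t that by (simp add: abs_le_iff)
        also have "\<dots> \<le> (t + 1 / t) * (t + x)"
          using t that by (simp add: field_simps)
        finally show ?thesis using t that by (simp add: abs_divide divide_le_eq add_pos_nonneg)
      qed
    qed measurable
    have "(LINT x|\<rho>. ((1 + w) * x - 1) / (1 + w + x)) - (LINT x|\<rho>. (1 * x - 1) / (1 + x))
        = (LINT x|\<rho>. ((1 + w) * x - 1) / (1 + w + x) - (1 * x - 1) / (1 + x))"
      using int[of "1 + w"] int[of 1] w' by simp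
    also have "\<dots> = (LINT x|\<rho>. w * (moebius_weight x / (1 + w * ?y x)))"
    proof (rule integral_cong_AE)
      show "AE x in \<rho>. ((1 + w) * x - 1) / (1 + w + x) - (1 * x - 1) / (1 + x)
          = w * (moebius_weight x / (1 + w * ?y x))"
        using AE_nonneg
      proof eventually_elim
        case (elim x)
        have nz: "1 + w + x \<noteq> 0" "1 + x \<noteq> 0" "1 + x + w \<noteq> 0" using elim w' by auto
        have "1 + w * ?y x = (1 + w + x) / (1 + x)" using nz by (simp add: field_simps)
        then show ?case
          using nz unfolding moebius_weight_def
          by (simp add: divide_simps) (simp add: algebra_simps power2_eq_square)
      qed
    qed measurable
    also have "\<dots> = w * (LINT x|\<rho>. moebius_weight x / (1 + w * ?y x))"
      by (rule integral_mult_right_zero)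
    finally show ?thesis unfolding J_def by argo
  qed
  finally have "(\<lambda>k. (\<lambda>n. (case n of 0 \<Rightarrow> 0 | Suc k \<Rightarrow> (- 1) ^ k * moebius_integral b \<rho> (\<lambda>y. y ^ k)) * w ^ n) (Suc k))
      sums (J (1 + w) - J 1)" by simp
  then show ?thesis by (subst (asm) sums_Suc_iff) simp
qed

end

text \<open>
  Equal moments give equal integrals of polynomials, and polynomials are uniformly dense in the
  continuous functions on \<open>[0, 1]\<close>.
\<close>

lemma moebius_integral_eq_continuous:
  assumes "half_line_measure \<rho>" "half_line_measure \<rho>'" "b \<ge> 0" "b' \<ge> 0"
    and moments: "\<And>n. moebius_integral b \<rho> (\<lambda>y. y ^ n) = moebius_integral b' \<rho>' (\<lambda>y. y ^ n)"
    and f: "continuous_on UNIV f"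
  shows "moebius_integral b \<rho> f = moebius_integral b' \<rho>' f"
proof -
  interpret R: half_line_measure \<rho> by fact
  interpret R': half_line_measure \<rho>' by fact
  define C where "C = b + measure \<rho> UNIV + (b' + measure \<rho>' UNIV)"
  have C: "C \<ge> 0" unfolding C_def using assms by simp
  have f_cont: "continuous_on {0..1} f" using f continuous_on_subset by blast
  have f_meas [measurable]: "f \<in> borel_measurable borel"
    using f borel_measurable_continuous_onI by blast
  obtain Bf where Bf: "\<And>y. y \<in> {0..1} \<Longrightarrow> \<bar>f y\<bar> \<le> Bf"
    using compact_imp_bounded[OF compact_continuous_image[OF f_cont compact_Icc]]
    unfolding bounded_iff ball_simps real_norm_def by blast
  have close: "\<bar>moebius_integral b \<rho> f - moebius_integral b' \<rho>' f\<bar> \<le> e * C" if e: "e > 0" for e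
  proof -
    obtain p where p: "real_polynomial_function p" "\<And>y. y \<in> {0..1} \<Longrightarrow> \<bar>f y - p y\<bar> < e"
      using Stone_Weierstrass_real_polynomial_function[OF _ f_cont e] by auto
    obtain q n where q: "p = (\<lambda>y. \<Sum>i\<le>n. q i * y ^ i)"
      using p(1) real_polynomial_function_iff_sum by blast
    have p_meas [measurable]: "p \<in> borel_measurable borel" unfolding q by measurable
    have p_bound: "\<bar>p y\<bar> \<le> Bf + e" if "y \<in> {0..1}" for y
      using p(2)[OF that] Bf[OF that] by linarith
    have eq: "moebius_integral b \<rho> p = moebius_integral b' \<rho>' p"
      unfolding q R.moebius_integral_polynomial R'.moebius_integral_polynomial moments ..
    have "\<bar>moebius_integral b \<rho> f - moebius_integral b \<rho> p\<bar> \<le> e * (b + measure \<rho> UNIV)"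
      using R.moebius_integral_bound[of "\<lambda>y. f y - p y" b e]
        R.moebius_integral_diff[OF f_meas p_meas, of Bf "Bf + e" b] Bf p_bound p(2) assms(3,4)
      by (auto intro: less_imp_le)
    moreover have "\<bar>moebius_integral b' \<rho>' f - moebius_integral b' \<rho>' p\<bar> \<le> e * (b' + measure \<rho>' UNIV)"
      using R'.moebius_integral_bound[of "\<lambda>y. f y - p y" b' e]
        R'.moebius_integral_diff[OF f_meas p_meas, of Bf "Bf + e" b'] Bf p_bound p(2) assms(3,4)
      by (auto intro: less_imp_le)
    ultimately show ?thesis
      unfolding C_def distrib_left[of e "b + measure \<rho> UNIV"] using eq by linarith
  qed
  show ?thesis
  proof (rule ccontr)
    assume "\<not> ?thesis"
    then have d: "0 < \<bar>moebius_integral b \<rho> f - moebius_integral b' \<rho>' f\<bar>" (is "0 < ?d") by simp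
    then have "?d \<le> ?d / (2 * (C + 1)) * C"
      using close[of "?d / (2 * (C + 1))"] C by simp
    also have "\<dots> < ?d"
    proof -
      have "C / (2 * (C + 1)) < 1" using C by simp
      from mult_strict_left_mono[OF this d] show ?thesis by simp
    qed
    finally show False by simp
  qed
qed

text \<open>
  The ramps are continuous functions that decrease to the indicator of \<open>[t, \<infinity>)\<close>. As \<open>t > 0\<close>, the
  mass \<open>b\<close> at \<open>y = 0\<close> disappears in the limit, so that \<open>\<rho>\<close> is separated from \<open>b\<close>.
\<close>

lemma (in half_line_measure) moebius_integral_ramp_limit:
  assumes t: "t > 0"
  shows "(\<lambda>k. moebius_integral b \<rho> (\<lambda>y. max 0 (min 1 (1 + real k * (y - t)))))
    \<longlonglongrightarrow> (LINT x|\<rho>. moebius_weight x * indicator {t..} (1 / (1 + x)))"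
proof -
  let ?f = "\<lambda>k y. max 0 (min 1 (1 + real k * (y - t)))"
  have lim: "(\<lambda>k. ?f k y) \<longlonglongrightarrow> indicator {t..} y" for y
  proof (cases "y \<ge> t")
    case True
    then show ?thesis by (auto simp: min_def intro!: tendsto_eventually)
  next
    case False
    obtain N where N: "real N > 1 / (t - y)" using reals_Archimedean2 by blast
    have "?f k y = 0" if "k \<ge> N" for k
    proof -
      have "real k > 1 / (t - y)" using N that by (meson less_le_trans of_nat_mono)
      then have "real k * (t - y) > 1" using False by (simp add: field_simps)
      then show ?thesis by (simp add: algebra_simps)
    qed
    then have "\<forall>\<^sub>F k in sequentially. ?f k y = indicator {t..} y"
      using False unfolding eventually_sequentially by (intro exI[of _ N]) auto
    then show ?thesis by (rule tendsto_eventually)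
  qed
  have "(\<lambda>k. LINT x|\<rho>. moebius_weight x * ?f k (1 / (1 + x)))
      \<longlonglongrightarrow> (LINT x|\<rho>. moebius_weight x * indicator {t..} (1 / (1 + x)))"
  proof (rule integral_dominated_convergence[where w = "\<lambda>_. 1"])
    show "AE x in \<rho>. (\<lambda>k. moebius_weight x * ?f k (1 / (1 + x)))
        \<longlonglongrightarrow> moebius_weight x * indicator {t..} (1 / (1 + x))"
      by (intro AE_I2 tendsto_mult tendsto_const lim)
    show "AE x in \<rho>. norm (moebius_weight x * ?f k (1 / (1 + x))) \<le> 1" for k
      using AE_nonneg
    proof eventually_elim
      case (elim x)
      then show ?case
        using moebius_weight_le_1[OF elim] moebius_weight_nonneg[of x]
        by (auto simp: abs_mult intro!: mult_le_one)
    qed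
  qed auto
  from tendsto_add[OF tendsto_mult[OF tendsto_const lim[of 0]] this, of b]
  show ?thesis
    using t unfolding moebius_integral_def by simp
qed

lemma (in half_line_measure) finite_borel_measure_moebius:
  "finite_borel_measure (density \<rho> moebius_weight)"
proof -
  have "emeasure (density \<rho> moebius_weight) UNIV = (\<integral>\<^sup>+x. moebius_weight x \<partial>\<rho>)"
    by (simp add: emeasure_density)
  also have "\<dots> \<le> (\<integral>\<^sup>+x. 1 \<partial>\<rho>)"
    using AE_nonneg by (intro nn_integral_mono_AE) (auto elim!: eventually_mono simp: moebius_weight_le_1)
  also have "\<dots> < \<infinity>" by (simp add: less_top[symmetric])
  finally have "finite_measure (density \<rho> moebius_weight)"
    by (intro finite_measureI) auto
  then show ?thesis
    by (simp add: finite_borel_measure_def finite_borel_measure_axioms_def sets_eq)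
qed

text \<open>
  The substitution \<open>y = 1 / (1 + x)\<close> reverses the order, so upper tails in \<open>y\<close> are exactly values of
  the distribution function in \<open>x\<close>.
\<close>

lemma (in half_line_measure) cdf_moebius:
  "cdf (density \<rho> moebius_weight) s =
    (if s < 0 then 0 else (LINT x|\<rho>. moebius_weight x * indicator {1 / (1 + s)..} (1 / (1 + x))))"
proof -
  interpret D: finite_borel_measure "density \<rho> moebius_weight"
    by (rule finite_borel_measure_moebius)
  have "cdf (density \<rho> moebius_weight) s = (LINT x|density \<rho> moebius_weight. indicator {..s} x)"
    unfolding cdf_def by simp
  also have "\<dots> = (LINT x|\<rho>. moebius_weight x * indicator {..s} x)"
    by (subst integral_density) (auto simp: moebius_weight_nonneg)
  also have "\<dots> = (LINT x|\<rho>. (if s < 0 then 0 else moebius_weight x * indicator {1 / (1 + s)..} (1 / (1 + x))))"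
  proof (rule integral_cong_AE)
    show "AE x in \<rho>. moebius_weight x * indicator {..s} x =
        (if s < 0 then 0 else moebius_weight x * indicator {1 / (1 + s)..} (1 / (1 + x)))"
      using AE_nonneg
    proof eventually_elim
      case (elim x)
      have "x \<le> s \<longleftrightarrow> 1 / (1 + s) \<le> 1 / (1 + x)" if "\<not> s < 0"
        using that elim by (simp add: divide_le_eq pos_le_divide_eq)
      then show ?case using elim by (cases "s < 0") (auto simp: indicator_def)
    qed
  qed auto
  finally show ?thesis by simp
qed

text \<open>
  The weight is positive on \<open>[0, \<infinity>)\<close>, hence \<open>\<rho>\<close> can be recovered from the weighted measure.
\<close>

lemma (in half_line_measure) density_moebius_inverse:
  "density (density \<rho> moebius_weight) (\<lambda>x. 1 / moebius_weight x) = \<rho>"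
proof -
  have "density (density \<rho> moebius_weight) (\<lambda>x. 1 / moebius_weight x)
      = density \<rho> (\<lambda>x. ennreal (moebius_weight x) * ennreal (1 / moebius_weight x))"
    by (rule density_density_eq) auto
  also have "\<dots> = density \<rho> (\<lambda>_. 1)"
  proof (rule density_cong)
    show "AE x in \<rho>. ennreal (moebius_weight x) * ennreal (1 / moebius_weight x) = 1"
      using AE_nonneg
    proof eventually_elim
      case (elim x)
      then show ?case using moebius_weight_pos[OF elim]
        by (simp flip: ennreal_mult)
    qed
  qed auto
  finally show ?thesis by (simp add: density_1)
qed

text \<open>
  The Hausdorff moment problem on \<open>[0, 1]\<close> is determinate: the moments fix the tails by
  approximation with ramps, the tails fix the weighted measure, and then the zeroth moment fixes \<open>b\<close>.
\<close>

lemma moebius_moments_determine: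
  assumes "half_line_measure \<rho>" "half_line_measure \<rho>'" "b \<ge> 0" "b' \<ge> 0"
    and moments: "\<And>n. moebius_integral b \<rho> (\<lambda>y. y ^ n) = moebius_integral b' \<rho>' (\<lambda>y. y ^ n)"
  shows "b = b'" "\<rho> = \<rho>'"
proof -
  interpret R: half_line_measure \<rho> by fact
  interpret R': half_line_measure \<rho>' by fact
  have tails: "(LINT x|\<rho>. moebius_weight x * indicator {t..} (1 / (1 + x)))
      = (LINT x|\<rho>'. moebius_weight x * indicator {t..} (1 / (1 + x)))" if "t > 0" for t
  proof (rule LIMSEQ_unique[OF R.moebius_integral_ramp_limit[OF that, of b]])
    have "moebius_integral b \<rho> (\<lambda>y. max 0 (min 1 (1 + real k * (y - t))))
        = moebius_integral b' \<rho>' (\<lambda>y. max 0 (min 1 (1 + real k * (y - t))))" for k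
      by (rule moebius_integral_eq_continuous[OF assms]) (intro continuous_intros)
    then show "(\<lambda>k. moebius_integral b \<rho> (\<lambda>y. max 0 (min 1 (1 + real k * (y - t)))))
        \<longlonglongrightarrow> (LINT x|\<rho>'. moebius_weight x * indicator {t..} (1 / (1 + x)))"
      using R'.moebius_integral_ramp_limit[OF that, of b'] by simp
  qed
  have "density \<rho> moebius_weight = density \<rho>' moebius_weight"
  proof (rule cdf_unique')
    show "cdf (density \<rho> moebius_weight) = cdf (density \<rho>' moebius_weight)"
      unfolding R.cdf_moebius R'.cdf_moebius fun_eq_iff using tails by auto
  qed (rule R.finite_borel_measure_moebius R'.finite_borel_measure_moebius)+
  then show \<rho>: "\<rho> = \<rho>'"
    using R.density_moebius_inverse R'.density_moebius_inverse by metis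
  show "b = b'"
    using moments[of 0] unfolding moebius_integral_def \<rho> by simp
qed

lemma NP_characteristics_half_line:
  assumes "NP_characteristics F a b \<rho>"
  shows "half_line_measure \<rho>"
  using assms unfolding NP_characteristics_def half_line_measure_def half_line_measure_axioms_def by auto

lemma NP_characteristics_real:
  assumes "NP_characteristics F a b \<rho>" and t: "t > 0"
  shows "F (of_real t) = of_real (a + (b * t + (LINT x|\<rho>. (t * x - 1) / (t + x))))"
proof -
  interpret half_line_measure \<rho> using NP_characteristics_half_line[OF assms(1)] .
  have "complex_of_real t \<in> - \<real>\<^sub>\<le>\<^sub>0" using t by (auto simp: complex_nonpos_Reals_iff)
  then have "F (of_real t) = of_real a + of_real b * of_real t +
      (LINT x:{0..}|\<rho>. (of_real t * of_real x - 1) / (of_real t + of_real x))"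
    using assms(1) unfolding NP_characteristics_def by blast
  also have "(LINT x:{0..}|\<rho>. (complex_of_real t * of_real x - 1) / (of_real t + of_real x))
      = (LINT x|\<rho>. complex_of_real ((t * x - 1) / (t + x)))"
    by (subst set_integral_half_line) auto
  also have "\<dots> = of_real (LINT x|\<rho>. (t * x - 1) / (t + x))"
    by (rule integral_complex_of_real)
  finally show ?thesis by simp
qed

text \<open>
  Both functions have a power series around \<open>1\<close> whose coefficients are the moments, so comparing
  coefficients reduces the claim to determinacy of the moment problem. The constant \<open>a\<close> then follows
  by evaluation at \<open>1\<close>.
\<close>

lemma NP_characteristics_unique:
  assumes F: "NP_characteristics F a b \<rho>" and F': "NP_characteristics F' a' b' \<rho>'"
    and eq: "\<And>t. t > 0 \<Longrightarrow> F (of_real t) = F' (of_real t)"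
  shows "a = a'" "b = b'" "\<rho> = \<rho>'"
proof -
  interpret R: half_line_measure \<rho> using NP_characteristics_half_line[OF F] .
  interpret R': half_line_measure \<rho>' using NP_characteristics_half_line[OF F'] .
  define J where "J = (\<lambda>t. b * t + (LINT x|\<rho>. (t * x - 1) / (t + x)))"
  define J' where "J' = (\<lambda>t. b' * t + (LINT x|\<rho>'. (t * x - 1) / (t + x)))"
  have J: "a + J t = a' + J' t" if "t > 0" for t
    using eq[OF that] unfolding NP_characteristics_real[OF F that] NP_characteristics_real[OF F' that]
      J_def J'_def of_real_eq_iff .
  let ?m = "\<lambda>n::nat. case n of 0 \<Rightarrow> 0 | Suc k \<Rightarrow> (- 1) ^ k * moebius_integral b \<rho> (\<lambda>y. y ^ k)"
  let ?m' = "\<lambda>n::nat. case n of 0 \<Rightarrow> 0 | Suc k \<Rightarrow> (- 1) ^ k * moebius_integral b' \<rho>' (\<lambda>y. y ^ k)"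
  have zero: "(\<lambda>n. (?m n - ?m' n) * (w - 0) ^ n) sums 0" if "norm (w - 0) < 1" for w :: real
  proof -
    have w: "\<bar>w\<bar> < 1" using that by simp
    have "(\<lambda>n. ?m n * w ^ n - ?m' n * w ^ n) sums ((J (1 + w) - J 1) - (J' (1 + w) - J' 1))"
      unfolding J_def J'_def by (intro sums_diff R.Pick_power_series R'.Pick_power_series w)
    moreover have "(J (1 + w) - J 1) - (J' (1 + w) - J' 1) = 0"
      using J[of "1 + w"] J[of 1] w by linarith
    ultimately show ?thesis by (simp add: left_diff_distrib)
  qed
  have moments: "moebius_integral b \<rho> (\<lambda>y. y ^ k) = moebius_integral b' \<rho>' (\<lambda>y. y ^ k)" for k
  proof (rule ccontr)
    assume "\<not> ?thesis"
    then have nz: "?m (Suc k) - ?m' (Suc k) \<noteq> 0" by simp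
    \<comment> \<open>A nonzero coefficient would keep the power series of the zero function away from \<open>0\<close> on a punctured ball.\<close>
    obtain s where s: "0 < s" "\<And>w::real. w \<in> cball 0 s - {0} \<Longrightarrow> (0::real) \<noteq> 0"
      by (rule powser_0_nonzero[of 1 0 "\<lambda>n. ?m n - ?m' n" "\<lambda>_. 0" "Suc k"])
        (use zero nz in auto)
    show False using s(2)[of s] s(1) by auto
  qed
  note * = moebius_moments_determine[OF R.half_line_measure_axioms R'.half_line_measure_axioms _ _ moments]
  show b: "b = b'" and \<rho>: "\<rho> = \<rho>'"
    using * F F' unfolding NP_characteristics_def by auto
  show "a = a'" using J[of 1] unfolding J_def J'_def b \<rho> by simp
qed

lemma NP_characteristics_determine:
  assumes "NP_characteristics F a b \<rho>" "NP_characteristics F' a b \<rho>"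
  shows "F = F'"
proof
  fix z
  show "F z = F' z"
    using assms unfolding NP_characteristics_def extensional_def
    by (cases "z \<in> - \<real>\<^sub>\<le>\<^sub>0") auto
qed

section \<open>Levy measures and finite measures on the half-line\<close>

lemma sets_Theta_measure [simp, measurable_cong]: "sets (Theta_measure \<gamma> \<nu>) = sets borel"
  unfolding Theta_measure_def
  using sets.sets_measure_of_eq[of "borel :: real measure"] by simp

text \<open>
  The set function in the definition of \<open>Theta_measure\<close> is a sum of two measures, hence countably
  additive, and so its values are really those of the measure that it generates.
\<close>

lemma emeasure_Theta_measure:
  assumes [measurable_cong]: "sets \<nu> = sets borel" and A [measurable]: "A \<in> sets borel"
  shows "emeasure (Theta_measure \<gamma> \<nu>) A = ennreal (\<gamma>\<^sup>2) * indicator A 0 +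
    (\<integral>\<^sup>+x. ennreal (x\<^sup>2 / (1 + x\<^sup>2)) * indicator A x \<partial>\<nu>)"
proof -
  let ?M = "scale_measure (ennreal (\<gamma>\<^sup>2)) (return borel (0::real))"
  let ?N = "density \<nu> (\<lambda>x. ennreal (x\<^sup>2 / (1 + x\<^sup>2)))"
  have "emeasure (Theta_measure \<gamma> \<nu>) A = emeasure ?M A + emeasure ?N A"
    unfolding Theta_measure_def
  proof (rule emeasure_measure_of_sigma)
    show "sigma_algebra UNIV (sets (borel :: real measure))"
      using sets.sigma_algebra_axioms[of "borel :: real measure"] by simp
    show "countably_additive (sets borel) (\<lambda>A. emeasure ?M A + emeasure ?N A)"
    proof (rule countably_additiveI)
      fix B :: "nat \<Rightarrow> real set"
      assume B: "range B \<subseteq> sets borel" "disjoint_family B"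
      have "(\<Sum>i. emeasure ?M (B i) + emeasure ?N (B i)) = (\<Sum>i. emeasure ?M (B i)) + (\<Sum>i. emeasure ?N (B i))"
        by (rule suminf_add[symmetric]) (rule summableI)+
      also have "(\<Sum>i. emeasure ?M (B i)) = emeasure ?M (\<Union>i. B i)"
        using B by (intro suminf_emeasure) auto
      also have "(\<Sum>i. emeasure ?N (B i)) = emeasure ?N (\<Union>i. B i)"
        using B assms(1) by (intro suminf_emeasure) auto
      finally show "(\<Sum>i. emeasure ?M (B i) + emeasure ?N (B i))
        = emeasure ?M (\<Union>i. B i) + emeasure ?N (\<Union>i. B i)" .
    qed
  qed (use A in \<open>auto simp: positive_def\<close>)
  then show ?thesis
    by (simp add: emeasure_density assms(1))
qed

locale Levy_measure =
  fixes \<nu> :: "real measure"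
  assumes sets_eq [measurable_cong]: "sets \<nu> = sets borel"
    and nonpos_null: "emeasure \<nu> {..0} = 0"
    and min_integral: "(\<integral>\<^sup>+x. ennreal (min (x\<^sup>2) 1) \<partial>\<nu>) < \<infinity>"
begin

lemma AE_pos: "AE x in \<nu>. 0 < x"
  by (rule AE_I[where N = "{..0}"]) (use nonpos_null sets_eq in auto)

lemma half_line_Theta_measure: "half_line_measure (Theta_measure \<gamma> \<nu>)"
proof (unfold half_line_measure_def half_line_measure_axioms_def, intro conjI)
  have "(\<integral>\<^sup>+x. ennreal (x\<^sup>2 / (1 + x\<^sup>2)) \<partial>\<nu>) \<le> (\<integral>\<^sup>+x. ennreal (min (x\<^sup>2) 1) \<partial>\<nu>)"
  proof (rule nn_integral_mono, rule ennreal_leI)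
    fix x :: real
    have "0 < 1 + x\<^sup>2" by (simp add: add_pos_nonneg)
    then show "x\<^sup>2 / (1 + x\<^sup>2) \<le> min (x\<^sup>2) 1"
      using mult_left_mono[of 1 "1 + x\<^sup>2" "x\<^sup>2"] by (simp add: divide_le_eq)
  qed
  then have "(\<integral>\<^sup>+x. ennreal (x\<^sup>2 / (1 + x\<^sup>2)) \<partial>\<nu>) < \<infinity>"
    using min_integral by (rule le_less_trans)
  then have "emeasure (Theta_measure \<gamma> \<nu>) UNIV \<noteq> \<infinity>"
    using sets_eq by (simp add: emeasure_Theta_measure)
  moreover have "space (Theta_measure \<gamma> \<nu>) = UNIV"
    using sets_eq_imp_space_eq[OF sets_Theta_measure, of \<gamma> \<nu>] by simp
  ultimately show "finite_measure (Theta_measure \<gamma> \<nu>)"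
    by (intro finite_measureI) simp
  have "(\<integral>\<^sup>+x. ennreal (x\<^sup>2 / (1 + x\<^sup>2)) * indicator {..<0} x \<partial>\<nu>) = (\<integral>\<^sup>+x. 0 \<partial>\<nu>)"
    using AE_pos by (intro nn_integral_cong_AE) (auto elim!: eventually_mono)
  then show "emeasure (Theta_measure \<gamma> \<nu>) {..<0} = 0"
    using sets_eq by (simp add: emeasure_Theta_measure)
qed simp

text \<open>
  Off the origin the measure has only its \<open>\<nu>\<close>-part. Stated as an equality of measures, it
  transfers integrals from one side to the other.
\<close>

lemma density_Theta_measure_pos:
  "density (Theta_measure \<gamma> \<nu>) (\<lambda>x. ennreal (indicator {0<..} x)) = density \<nu> (\<lambda>x. ennreal (x\<^sup>2 / (1 + x\<^sup>2)))"
proof (rule measure_eqI)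
  fix A assume "A \<in> sets (density (Theta_measure \<gamma> \<nu>) (\<lambda>x. ennreal (indicator {0<..} x)))"
  then have A [measurable]: "A \<in> sets borel" by simp
  have "emeasure (density (Theta_measure \<gamma> \<nu>) (\<lambda>x. ennreal (indicator {0<..} x))) A
      = (\<integral>\<^sup>+x. ennreal (indicator {0<..} x) * indicator A x \<partial>Theta_measure \<gamma> \<nu>)"
    by (rule emeasure_density) auto
  also have "\<dots> = (\<integral>\<^sup>+x. indicator ({0<..} \<inter> A) x \<partial>Theta_measure \<gamma> \<nu>)"
    by (rule nn_integral_cong) (simp add: indicator_def)
  also have "\<dots> = emeasure (Theta_measure \<gamma> \<nu>) ({0<..} \<inter> A)"
    by (rule nn_integral_indicator) simp
  also have "\<dots> = (\<integral>\<^sup>+x. ennreal (x\<^sup>2 / (1 + x\<^sup>2)) * indicator ({0<..} \<inter> A) x \<partial>\<nu>)"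
    using sets_eq by (simp add: emeasure_Theta_measure)
  also have "\<dots> = (\<integral>\<^sup>+x. ennreal (x\<^sup>2 / (1 + x\<^sup>2)) * indicator A x \<partial>\<nu>)"
    using AE_pos by (intro nn_integral_cong_AE) (auto elim!: eventually_mono simp: indicator_def)
  also have "\<dots> = emeasure (density \<nu> (\<lambda>x. ennreal (x\<^sup>2 / (1 + x\<^sup>2)))) A"
    using sets_eq by (simp add: emeasure_density)
  finally show "emeasure (density (Theta_measure \<gamma> \<nu>) (\<lambda>x. ennreal (indicator {0<..} x))) A
      = emeasure (density \<nu> (\<lambda>x. ennreal (x\<^sup>2 / (1 + x\<^sup>2)))) A" .
qed (simp add: sets_eq)

text \<open>
  The mass \<open>\<gamma>\<^sup>2\<close> at the origin meets \<open>K(t, 0) = t\<^sup>2 / 2\<close> and yields the Gaussian term; on \<open>(0, \<infinity>)\<close> the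
  density \<open>x\<^sup>2 / (1 + x\<^sup>2)\<close> cancels the factor of the kernel.
\<close>

lemma integral_compensated_kernel:
  assumes t: "t \<ge> 0"
  shows "(LINT x|Theta_measure \<gamma> \<nu>. compensated_kernel t x) = \<gamma>\<^sup>2 / 2 * t\<^sup>2 +
    (LINT x:{0<..}|\<nu>. exp (- t * x) - 1 + t * (x / (1 + x\<^sup>2)))"
proof -
  let ?\<Theta> = "Theta_measure \<gamma> \<nu>" and ?K = "compensated_kernel t"
  interpret T: half_line_measure ?\<Theta> by (rule half_line_Theta_measure)
  have int: "integrable ?\<Theta> ?K"
    by (rule T.integrable_bounded_half_line) (use compensated_kernel_bound[OF t] in auto)
  have "(LINT x|?\<Theta>. ?K x) = (LINT x|?\<Theta>. indicator {0} x * ?K 0 + indicator {0<..} x * ?K x)"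
    using T.AE_nonneg by (intro integral_cong_AE) (auto elim!: eventually_mono simp: indicator_def)
  also have "\<dots> = (LINT x|?\<Theta>. indicator {0} x * ?K 0) + (LINT x|?\<Theta>. indicator {0<..} x * ?K x)"
  proof (rule Bochner_Integration.integral_add)
    show "integrable ?\<Theta> (\<lambda>x. indicator {0} x * ?K 0)"
      by (intro integrable_mult_left integrable_real_indicator) (auto simp: less_top[symmetric])
    show "integrable ?\<Theta> (\<lambda>x. indicator {0<..} x * ?K x)"
      using integrable_mult_indicator[OF _ int, of "{0<..}"] by simp
  qed
  also have "(LINT x|?\<Theta>. indicator {0} x * ?K 0) = \<gamma>\<^sup>2 / 2 * t\<^sup>2"
  proof -
    have "(\<integral>\<^sup>+x. ennreal (x\<^sup>2 / (1 + x\<^sup>2)) * indicator {0} x \<partial>\<nu>) = (\<integral>\<^sup>+x. 0 \<partial>\<nu>)"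
      by (intro nn_integral_cong) (auto simp: indicator_def)
    then have "emeasure ?\<Theta> {0} = ennreal (\<gamma>\<^sup>2)"
      using sets_eq by (simp add: emeasure_Theta_measure)
    then show ?thesis by (simp add: measure_def compensated_kernel_def)
  qed
  also have "(LINT x|?\<Theta>. indicator {0<..} x * ?K x) = (LINT x|density ?\<Theta> (\<lambda>x. ennreal (indicator {0<..} x)). ?K x)"
    by (subst integral_density) auto
  also have "\<dots> = (LINT x|\<nu>. x\<^sup>2 / (1 + x\<^sup>2) * ?K x)"
    unfolding density_Theta_measure_pos by (subst integral_density) (auto simp: sets_eq)
  also have "\<dots> = (LINT x:{0<..}|\<nu>. exp (- t * x) - 1 + t * (x / (1 + x\<^sup>2)))"
    unfolding set_lebesgue_integral_def
  proof (rule integral_cong_AE)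
    show "AE x in \<nu>. x\<^sup>2 / (1 + x\<^sup>2) * ?K x
        = indicator {0<..} x *\<^sub>R (exp (- t * x) - 1 + t * (x / (1 + x\<^sup>2)))"
      using AE_pos
    proof eventually_elim
      case (elim x)
      have "x\<^sup>2 / (1 + x\<^sup>2) * ((1 + x\<^sup>2) / x\<^sup>2) = 1"
        using elim by (simp add: add_nonneg_eq_0_iff)
      then have "x\<^sup>2 / (1 + x\<^sup>2) * ((1 + x\<^sup>2) / x\<^sup>2 * r) = r" for r
        by (simp only: mult.assoc[symmetric] mult_1)
      from this[of "exp (- t * x) - 1 + t * (x / (1 + x\<^sup>2))"] show ?case
        using elim unfolding compensated_kernel_def by simp
    qed
  qed measurable
  finally show ?thesis .
qed

end

lemma LE_characteristics_Levy_measure: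
  assumes "LE_characteristics \<Psi> \<alpha> \<beta> \<gamma> \<nu>"
  shows "Levy_measure \<nu>"
  using assms unfolding LE_characteristics_def Levy_measure_def by auto

lemma LE_characteristics_kernel:
  assumes "LE_characteristics \<Psi> \<alpha> \<beta> \<gamma> \<nu>" and t: "t \<ge> 0"
  shows "\<Psi> t = \<alpha> + \<beta> * t + (LINT x|Theta_measure \<gamma> \<nu>. compensated_kernel t x)"
  using assms Levy_measure.integral_compensated_kernel[OF LE_characteristics_Levy_measure[OF assms(1)] t]
  unfolding LE_characteristics_def by simp

text \<open>
  Take \<open>\<gamma>\<^sup>2 = \<rho>({0})\<close> and \<open>\<nu>(dx) = (1 + x\<^sup>2) / x\<^sup>2 \<rho>(dx)\<close> on \<open>(0, \<infinity>)\<close>. The density of \<open>\<nu>\<close> times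
  \<open>min (x\<^sup>2) 1\<close> is at most \<open>2\<close>, so finiteness of \<open>\<rho>\<close> gives the integrability condition.
\<close>

lemma (in half_line_measure) obtain_Levy_measure:
  obtains \<gamma> \<nu> where "\<gamma> \<ge> 0" "Levy_measure \<nu>" "Theta_measure \<gamma> \<nu> = \<rho>"
proof
  define \<gamma> where "\<gamma> = sqrt (measure \<rho> {0})"
  define w where "w x = (if x > 0 then (1 + x\<^sup>2) / x\<^sup>2 else 0)" for x :: real
  define \<nu> where "\<nu> = density \<rho> w"
  have w_meas [measurable]: "w \<in> borel_measurable borel" unfolding w_def by measurable
  have sets_\<nu> [measurable_cong]: "sets \<nu> = sets borel" unfolding \<nu>_def by (simp add: sets_eq)
  show "\<gamma> \<ge> 0" unfolding \<gamma>_def by simp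
  show "Levy_measure \<nu>"
  proof
    show "sets \<nu> = sets borel" by (rule sets_\<nu>)
    have "emeasure \<nu> {..0} = (\<integral>\<^sup>+x. ennreal (w x) * indicator {..0} x \<partial>\<rho>)"
      unfolding \<nu>_def by (simp add: emeasure_density sets_eq)
    also have "\<dots> = (\<integral>\<^sup>+x. 0 \<partial>\<rho>)"
      by (intro nn_integral_cong) (auto simp: w_def indicator_def)
    finally show "emeasure \<nu> {..0} = 0" by simp
    have "(\<integral>\<^sup>+x. ennreal (min (x\<^sup>2) 1) \<partial>\<nu>) = (\<integral>\<^sup>+x. ennreal (w x) * ennreal (min (x\<^sup>2) 1) \<partial>\<rho>)"
      unfolding \<nu>_def by (subst nn_integral_density) auto
    also have "\<dots> \<le> (\<integral>\<^sup>+x. ennreal 2 \<partial>\<rho>)"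
    proof (rule nn_integral_mono)
      fix x :: real
      have "w x * min (x\<^sup>2) 1 \<le> 2"
        unfolding w_def by (cases "x\<^sup>2 \<le> 1") (simp_all add: min_def divide_le_eq)
      then have "ennreal (w x * min (x\<^sup>2) 1) \<le> ennreal 2" by (rule ennreal_leI)
      then show "ennreal (w x) * ennreal (min (x\<^sup>2) 1) \<le> ennreal 2"
        by (subst ennreal_mult[symmetric]) (auto simp: w_def)
    qed
    also have "\<dots> < \<infinity>" by (simp add: ennreal_mult_eq_top_iff less_top[symmetric])
    finally show "(\<integral>\<^sup>+x. ennreal (min (x\<^sup>2) 1) \<partial>\<nu>) < \<infinity>" .
  qed
  show "Theta_measure \<gamma> \<nu> = \<rho>"
  proof (rule measure_eqI)
    fix A assume "A \<in> sets (Theta_measure \<gamma> \<nu>)"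
    then have A [measurable]: "A \<in> sets borel" by simp
    have "(\<integral>\<^sup>+x. ennreal (x\<^sup>2 / (1 + x\<^sup>2)) * indicator A x \<partial>\<nu>)
        = (\<integral>\<^sup>+x. ennreal (w x) * (ennreal (x\<^sup>2 / (1 + x\<^sup>2)) * indicator A x) \<partial>\<rho>)"
      unfolding \<nu>_def by (subst nn_integral_density) auto
    also have "\<dots> = (\<integral>\<^sup>+x. indicator ({0<..} \<inter> A) x \<partial>\<rho>)"
    proof (rule nn_integral_cong)
      fix x :: real
      have "1 + x\<^sup>2 \<noteq> 0" by (simp add: add_nonneg_eq_0_iff)
      then have "w x * (x\<^sup>2 / (1 + x\<^sup>2)) = indicator {0<..} x"
        unfolding w_def by (auto simp: indicator_def)
      then have "ennreal (w x) * ennreal (x\<^sup>2 / (1 + x\<^sup>2)) = indicator {0<..} x"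
        by (subst ennreal_mult[symmetric]) (auto simp: w_def ennreal_indicator)
      then show "ennreal (w x) * (ennreal (x\<^sup>2 / (1 + x\<^sup>2)) * indicator A x) = indicator ({0<..} \<inter> A) x"
        by (simp add: mult.assoc[symmetric] indicator_inter_arith)
    qed
    also have "\<dots> = emeasure \<rho> ({0<..} \<inter> A)"
      by (rule nn_integral_indicator) (simp add: sets_eq)
    finally have pos: "(\<integral>\<^sup>+x. ennreal (x\<^sup>2 / (1 + x\<^sup>2)) * indicator A x \<partial>\<nu>) = emeasure \<rho> ({0<..} \<inter> A)" .
    have zero: "ennreal (\<gamma>\<^sup>2) * indicator A 0 = emeasure \<rho> ({0} \<inter> A)"
      unfolding \<gamma>_def by (auto simp: indicator_def emeasure_eq_measure)
    have "emeasure (Theta_measure \<gamma> \<nu>) A = emeasure \<rho> ({0} \<inter> A) + emeasure \<rho> ({0<..} \<inter> A)"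
      by (simp add: emeasure_Theta_measure sets_\<nu> pos zero)
    also have "\<dots> = emeasure \<rho> (({0} \<inter> A) \<union> ({0<..} \<inter> A))"
      by (intro plus_emeasure) (auto simp: sets_eq)
    also have "\<dots> = emeasure \<rho> A"
      using AE_nonneg by (intro emeasure_eq_AE) (auto elim!: eventually_mono simp: sets_eq)
    finally show "emeasure (Theta_measure \<gamma> \<nu>) A = emeasure \<rho> A" .
  qed (simp add: sets_eq)
qed

section \<open>The operator Theta\<close>

definition Pick_function :: "real \<Rightarrow> real \<Rightarrow> real measure \<Rightarrow> complex \<Rightarrow> complex" where
  "Pick_function a b \<rho> = (\<lambda>z. if z \<in> - \<real>\<^sub>\<le>\<^sub>0 then of_real a + of_real b * z +
     (LINT x:{0..}|\<rho>. (z * of_real x - 1) / (z + of_real x)) else undefined)"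

lemma (in half_line_measure) NP_characteristics_Pick_function:
  "b \<ge> 0 \<Longrightarrow> NP_characteristics (Pick_function a b \<rho>) a b \<rho>"
  unfolding NP_characteristics_def Pick_function_def
  using sets_eq neg_null finite_measure_axioms by (auto simp: extensional_def)

lemma C_plus_subset_slit: "z \<in> C_plus \<Longrightarrow> z \<in> - \<real>\<^sub>\<le>\<^sub>0"
  by (auto simp: C_plus_def complex_nonpos_Reals_iff)

lemma of_real_in_C_plus: "t > 0 \<Longrightarrow> of_real t \<in> C_plus"
  by (simp add: C_plus_def)

text \<open>
  For \<open>u \<ge> 0\<close> one has \<open>b + \<Psi>(0) - \<Psi>(u) = b - \<beta> u - \<integral> K(u, x) \<rho>(dx)\<close>: the constant \<open>\<alpha>\<close> cancels because
  \<open>K(0, x) = 0\<close>. The three terms are transformed one by one.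
\<close>

lemma Theta_integrand_Laplace:
  assumes LE: "LE_characteristics \<Psi> \<alpha> \<beta> \<gamma> \<nu>" and z: "z \<in> C_plus"
  shows "set_integrable lborel {0..} (Theta_integrand b \<Psi> z)"
    and "z\<^sup>2 * (LINT u:{0..}|lborel. Theta_integrand b \<Psi> z u) = of_real (- \<beta>) + of_real b * z +
      (LINT x:{0..}|Theta_measure \<gamma> \<nu>. (z * of_real x - 1) / (z + of_real x))"
proof -
  interpret T: half_line_measure "Theta_measure \<gamma> \<nu>"
    by (rule Levy_measure.half_line_Theta_measure[OF LE_characteristics_Levy_measure[OF LE]])
  have Rez: "Re z > 0" using z by (simp add: C_plus_def)
  then have z0: "z \<noteq> 0" by auto
  define g where "g u = (LINT x|Theta_measure \<gamma> \<nu>. compensated_kernel u x)" for u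
  let ?const = "\<lambda>u::real. exp (- z * of_real u) * of_real u ^ 0"
  let ?linear = "\<lambda>u::real. exp (- z * of_real u) * of_real u ^ 1"
  let ?kernel = "\<lambda>u::real. exp (- z * of_real u) * of_real (g u)"
  let ?sum = "\<lambda>u. of_real b * ?const u - of_real \<beta> * ?linear u - ?kernel u"
  have "compensated_kernel 0 = (\<lambda>_. 0)" by (simp add: compensated_kernel_def fun_eq_iff)
  then have "g 0 = 0" unfolding g_def by simp
  then have \<Psi>: "b + \<Psi> 0 - \<Psi> u = b - \<beta> * u - g u" if "u \<ge> 0" for u
    using LE_characteristics_kernel[OF LE that] LE_characteristics_kernel[OF LE order_refl]
    unfolding g_def by simp
  have eq: "Theta_integrand b \<Psi> z u = ?sum u" if "u \<in> {0..}" for u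
  proof -
    have "Theta_integrand b \<Psi> z u = exp (- z * of_real u) * of_real (b - \<beta> * u - g u)"
      using that unfolding Theta_integrand_def by (simp only: \<Psi> atLeast_iff)
    then show ?thesis by (simp add: algebra_simps)
  qed
  have i: "set_integrable lborel {0..} (\<lambda>u. of_real b * ?const u)"
    "set_integrable lborel {0..} (\<lambda>u. of_real \<beta> * ?linear u)"
    "set_integrable lborel {0..} ?kernel"
    using T.Laplace_compensated_integral(1)[OF Rez] Laplace_power(1)[OF Rez, of 0] Laplace_power(1)[OF Rez, of 1]
    unfolding g_def by (auto intro!: set_integrable_mult_right)
  have "set_integrable lborel {0..} (Theta_integrand b \<Psi> z) \<longleftrightarrow> set_integrable lborel {0..} ?sum"
    by (rule set_integrable_cong) (use eq in auto)
  then show "set_integrable lborel {0..} (Theta_integrand b \<Psi> z)"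
    using set_integral_diff(1)[OF set_integral_diff(1)[OF i(1,2)] i(3)] by simp
  have "(LINT u:{0..}|lborel. Theta_integrand b \<Psi> z u) = (LINT u:{0..}|lborel. ?sum u)"
    by (rule set_lebesgue_integral_cong) (use eq in auto)
  also have "\<dots> = of_real b * (LINT u:{0..}|lborel. ?const u)
      - of_real \<beta> * (LINT u:{0..}|lborel. ?linear u) - (LINT u:{0..}|lborel. ?kernel u)"
    using set_integral_diff(2)[OF set_integral_diff(1)[OF i(1,2)] i(3)] set_integral_diff(2)[OF i(1,2)]
    by (simp only: set_integral_mult_right)
  also have "\<dots> = of_real b / z - of_real \<beta> / z\<^sup>2 - (LINT u:{0..}|lborel. ?kernel u)"
    using Laplace_power(2)[OF Rez, of 0] Laplace_power(2)[OF Rez, of 1] by (simp add: power2_eq_square)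
  also have "z\<^sup>2 * \<dots> = of_real b * z - of_real \<beta> - z\<^sup>2 * (LINT u:{0..}|lborel. ?kernel u)"
    using z0 by (simp add: right_diff_distrib power2_eq_square)
  also have "z\<^sup>2 * (LINT u:{0..}|lborel. ?kernel u)
      = - (LINT x|Theta_measure \<gamma> \<nu>. (z * of_real x - 1) / (z + of_real x))"
    unfolding g_def by (rule T.Laplace_compensated_integral(2)[OF Rez])
  also have "(LINT x|Theta_measure \<gamma> \<nu>. (z * of_real x - 1) / (z + of_real x))
      = (LINT x:{0..}|Theta_measure \<gamma> \<nu>. (z * of_real x - 1) / (z + of_real x))"
    by (rule T.set_integral_half_line[symmetric]) measurable
  finally show "z\<^sup>2 * (LINT u:{0..}|lborel. Theta_integrand b \<Psi> z u) = of_real (- \<beta>) + of_real b * z +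
      (LINT x:{0..}|Theta_measure \<gamma> \<nu>. (z * of_real x - 1) / (z + of_real x))" by simp
qed

text \<open>
  Two members of the class that agree on the right half-plane have the same characteristics, and these
  determine them on the slit plane. So the definite description in the definition of \<open>Theta\<close> picks
  out the function with characteristics \<open>(-\<beta>, b, \<rho>)\<close>.
\<close>

lemma Theta_unique:
  assumes b: "b \<ge> 0" and LE: "LE_characteristics \<Psi> \<alpha> \<beta> \<gamma> \<nu>"
  defines "F \<equiv> Pick_function (- \<beta>) b (Theta_measure \<gamma> \<nu>)"
  shows "NP_characteristics F (- \<beta>) b (Theta_measure \<gamma> \<nu>)"
    and "z \<in> C_plus \<Longrightarrow> F z = z\<^sup>2 * (LINT u:{0..}|lborel. Theta_integrand b \<Psi> z u)"
    and "G \<in> Nevanlinna_Pick \<Longrightarrow>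
      \<forall>z\<in>C_plus. G z = z\<^sup>2 * (LINT u:{0..}|lborel. Theta_integrand b \<Psi> z u) \<Longrightarrow> G = F"
    and "Theta b \<Psi> = F"
proof -
  interpret T: half_line_measure "Theta_measure \<gamma> \<nu>"
    by (rule Levy_measure.half_line_Theta_measure[OF LE_characteristics_Levy_measure[OF LE]])
  show F: "NP_characteristics F (- \<beta>) b (Theta_measure \<gamma> \<nu>)"
    unfolding F_def by (rule T.NP_characteristics_Pick_function[OF b])
  show val: "F z = z\<^sup>2 * (LINT u:{0..}|lborel. Theta_integrand b \<Psi> z u)" if "z \<in> C_plus" for z
    using C_plus_subset_slit[OF that]
    unfolding F_def Pick_function_def Theta_integrand_Laplace(2)[OF LE that] by simp
  show uniq: "G = F" if G: "G \<in> Nevanlinna_Pick"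
    "\<forall>z\<in>C_plus. G z = z\<^sup>2 * (LINT u:{0..}|lborel. Theta_integrand b \<Psi> z u)" for G
  proof -
    obtain a b' \<rho> where c: "NP_characteristics G a b' \<rho>"
      using G(1) unfolding Nevanlinna_Pick_def by blast
    have "G (of_real t) = F (of_real t)" if "t > 0" for t
      using G(2) val of_real_in_C_plus[OF that] by metis
    note NP_characteristics_unique[OF c F this]
    then show ?thesis using NP_characteristics_determine c F by metis
  qed
  have "F \<in> Nevanlinna_Pick" using F unfolding Nevanlinna_Pick_def by blast
  with val have F_prop: "F \<in> Nevanlinna_Pick \<and>
      (\<forall>z\<in>C_plus. F z = z\<^sup>2 * (LINT u:{0..}|lborel. Theta_integrand b \<Psi> z u))" by blast
  show "Theta b \<Psi> = F"
    unfolding Theta_def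
  proof (rule the_equality)
    show "F \<in> Nevanlinna_Pick \<and>
      (\<forall>z\<in>C_plus. F z = z\<^sup>2 * (LINT u:{0..}|lborel. Theta_integrand b \<Psi> z u))" by (rule F_prop)
  qed (use uniq in blast)
qed

section \<open>Nevanlinna-Pick functions without linear part\<close>

text \<open>
  For \<open>Re z > 0\<close> and \<open>x \<ge> 0\<close> one has \<open>|z + x| \<ge> |z|\<close> and \<open>2 |z + x| \<ge> x + |z|\<close>. This bounds
  \<open>|F(z) / z|\<close> by a function \<open>h\<close> of \<open>|z|\<close> alone, which reduces the limit over the half-plane to
  a limit in one real variable, where dominated convergence applies.
\<close>

lemma NP_quotient_tendsto_0:
  assumes NP: "NP_characteristics F a 0 \<rho>"
  shows "((\<lambda>z. F z / z) \<longlongrightarrow> 0) (inf at_infinity (principal C_plus))"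
proof -
  interpret half_line_measure \<rho> using NP_characteristics_half_line[OF NP] .
  define M where "M = measure \<rho> UNIV"
  define h where "h r = \<bar>a\<bar> / r + ((LINT x|\<rho>. 2 * (x / (x + r))) + M / r\<^sup>2)" for r :: real
  have int_h: "integrable \<rho> (\<lambda>x. 2 * (x / (x + r)))" if "r > 0" for r
    by (rule integrable_bounded_half_line[where B = 2]) (use that in \<open>auto simp: divide_le_eq\<close>)
  have bound: "norm (F z / z) \<le> h (norm z)" if z: "z \<in> C_plus" for z
  proof -
    have Rez: "Re z > 0" using z by (simp add: C_plus_def)
    then have nz: "norm z > 0" by auto
    have pointwise: "norm ((z * of_real x - 1) / (z + of_real x) / z) \<le> 2 * (x / (x + norm z)) + 1 / (norm z)\<^sup>2"
      if x: "x \<ge> 0" for x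
    proof -
      have sq: "(norm (z + of_real x))\<^sup>2 = (norm z)\<^sup>2 + x\<^sup>2 + 2 * (Re z * x)"
        by (simp add: cmod_power2 power2_sum)
      have ge_z: "norm (z + of_real x) \<ge> norm z"
        by (rule power2_le_imp_le) (use sq Rez x in auto)
      have "(x + norm z)\<^sup>2 \<le> (2 * norm (z + of_real x))\<^sup>2"
      proof -
        have "0 \<le> (x - norm z)\<^sup>2 + (2 * x\<^sup>2 + 2 * (norm z)\<^sup>2 + 8 * (Re z * x))"
          using Rez x by (intro add_nonneg_nonneg mult_nonneg_nonneg) auto
        also have "\<dots> = 4 * ((norm z)\<^sup>2 + x\<^sup>2 + 2 * (Re z * x)) - (x + norm z)\<^sup>2"
          unfolding power2_sum power2_diff by (simp add: algebra_simps)
        finally have "(x + norm z)\<^sup>2 \<le> 4 * ((norm z)\<^sup>2 + x\<^sup>2 + 2 * (Re z * x))" by simp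
        then show ?thesis by (simp add: power_mult_distrib sq)
      qed
      then have ge_sum: "x + norm z \<le> 2 * norm (z + of_real x)"
        by (rule power2_le_imp_le) simp
      have pos: "norm (z + of_real x) > 0" using ge_z nz by linarith
      have "(z * of_real x - 1) / (z + of_real x) / z
          = of_real x / (z + of_real x) - 1 / (z * (z + of_real x))"
        using pos nz by (simp add: divide_simps)
      then have "norm ((z * of_real x - 1) / (z + of_real x) / z)
          \<le> norm (of_real x / (z + of_real x)) + norm (1 / (z * (z + of_real x)))"
        by (simp only: norm_triangle_ineq4)
      also have "norm (of_real x / (z + of_real x)) \<le> 2 * (x / (x + norm z))"
      proof -
        have "x / norm (z + of_real x) \<le> x / ((x + norm z) / 2)"
          using ge_sum x mult_pos_pos[OF pos add_nonneg_pos[OF x nz]] by (intro divide_left_mono) auto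
        then show ?thesis using x by (simp add: norm_divide mult.commute)
      qed
      also have "norm (1 / (z * (z + of_real x))) \<le> 1 / (norm z)\<^sup>2"
        using ge_z nz pos
        by (auto simp: norm_divide norm_mult power2_eq_square intro!: divide_left_mono mult_left_mono mult_pos_pos)
      finally show ?thesis by simp
    qed
    have "F z / z = of_real a / z + (LINT x|\<rho>. (z * of_real x - 1) / (z + of_real x) / z)"
    proof -
      have "F z = of_real a + (LINT x:{0..}|\<rho>. (z * of_real x - 1) / (z + of_real x))"
        using NP C_plus_subset_slit[OF z] unfolding NP_characteristics_def by simp
      also have "(LINT x:{0..}|\<rho>. (z * of_real x - 1) / (z + of_real x))
          = (LINT x|\<rho>. (z * of_real x - 1) / (z + of_real x))"
        by (rule set_integral_half_line) measurable
      finally show ?thesis by (simp only: add_divide_distrib integral_divide_zero)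
    qed
    then have "norm (F z / z) \<le> norm (of_real a / z) + norm (LINT x|\<rho>. (z * of_real x - 1) / (z + of_real x) / z)"
      by (simp only: norm_triangle_ineq)
    also have "norm (LINT x|\<rho>. (z * of_real x - 1) / (z + of_real x) / z)
        \<le> (LINT x|\<rho>. 2 * (x / (x + norm z)) + 1 / (norm z)\<^sup>2)"
    proof (rule order_trans[OF integral_norm_bound integral_mono_AE'])
      show "integrable \<rho> (\<lambda>x. 2 * (x / (x + norm z)) + 1 / (norm z)\<^sup>2)"
        using int_h[OF nz] by (intro Bochner_Integration.integrable_add) auto
      show "AE x in \<rho>. norm ((z * of_real x - 1) / (z + of_real x) / z) \<le> 2 * (x / (x + norm z)) + 1 / (norm z)\<^sup>2"
        using AE_nonneg pointwise by (auto elim!: eventually_mono)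
      show "AE x in \<rho>. 0 \<le> 2 * (x / (x + norm z)) + 1 / (norm z)\<^sup>2"
        using AE_nonneg by (auto elim!: eventually_mono)
    qed
    also have "\<dots> = (LINT x|\<rho>. 2 * (x / (x + norm z))) + M / (norm z)\<^sup>2"
      using int_h[OF nz] unfolding M_def by (subst Bochner_Integration.integral_add) auto
    finally show ?thesis unfolding h_def by (simp add: norm_divide)
  qed
  have "((\<lambda>r. LINT x|\<rho>. 2 * (x / (x + r))) \<longlongrightarrow> (LINT x|\<rho>. 0)) at_top"
  proof (rule integral_dominated_convergence_at_top[where w = "\<lambda>_. 2"])
    show "\<forall>\<^sub>F r in at_top. AE x in \<rho>. norm (2 * (x / (x + r))) \<le> 2"
      using eventually_gt_at_top[of 0]
    proof eventually_elim
      case (elim r)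
      show ?case using AE_nonneg by eventually_elim (use elim in \<open>auto simp: divide_le_eq\<close>)
    qed
    have "((\<lambda>r. 2 * (x / (x + r))) \<longlongrightarrow> 0) at_top" for x :: real by real_asymp
    then show "AE x in \<rho>. ((\<lambda>r. 2 * (x / (x + r))) \<longlongrightarrow> 0) at_top" by simp
  qed auto
  moreover have "((\<lambda>r. \<bar>a\<bar> / r) \<longlongrightarrow> 0) at_top" "((\<lambda>r. M / r\<^sup>2) \<longlongrightarrow> 0) at_top" by real_asymp+
  ultimately have "(h \<longlongrightarrow> 0 + (0 + 0)) at_top" unfolding h_def by (intro tendsto_add) simp_all
  then have "((\<lambda>z::complex. h (norm z)) \<longlongrightarrow> 0) at_infinity"
    using filterlim_compose[OF _ filterlim_norm_at_top] by simp
  then have "((\<lambda>z::complex. h (norm z)) \<longlongrightarrow> 0) (inf at_infinity (principal C_plus))"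
    by (rule tendsto_mono[rotated]) simp
  then show ?thesis
    by (rule Lim_null_comparison[rotated]) (auto simp: eventually_inf_principal bound)
qed

text \<open>
  The preimage may be chosen with \<open>\<alpha> = 0\<close>: \<open>\<Theta>\<close> only sees \<open>\<Psi>(0) - \<Psi>(u)\<close> and is therefore not
  injective in \<open>\<alpha>\<close>.
\<close>

lemma obtain_LE_preimage:
  assumes NP: "NP_characteristics F a 0 \<rho>"
  obtains \<Psi> where "\<Psi> \<in> Levy_Laplace" "Theta 0 \<Psi> = F"
proof -
  interpret half_line_measure \<rho> using NP_characteristics_half_line[OF NP] .
  obtain \<gamma> \<nu> where g: "\<gamma> \<ge> 0" "Levy_measure \<nu>" "Theta_measure \<gamma> \<nu> = \<rho>"
    by (rule obtain_Levy_measure)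
  define \<Psi> where "\<Psi> = restrict (\<lambda>t. 0 + (- a) * t + \<gamma>\<^sup>2 / 2 * t\<^sup>2 +
    (LINT x:{0<..}|\<nu>. exp (- t * x) - 1 + t * (x / (1 + x\<^sup>2)))) {0..}"
  have LE: "LE_characteristics \<Psi> 0 (- a) \<gamma> \<nu>"
    using g unfolding LE_characteristics_def \<Psi>_def Levy_measure_def by simp
  show thesis
  proof
    show "\<Psi> \<in> Levy_Laplace" using LE unfolding Levy_Laplace_def by blast
    have "NP_characteristics (Theta 0 \<Psi>) a 0 \<rho>"
      using Theta_unique(1,4)[OF order_refl LE] g(3) by simp
    then show "Theta 0 \<Psi> = F" using NP by (rule NP_characteristics_determine)
  qed
qed

theorem proposition1:
  shows "(\<forall>b \<Psi>. b \<ge> 0 \<and> \<Psi> \<in> Levy_Laplace \<longrightarrow>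
      (\<exists>!F. F \<in> Nevanlinna_Pick \<and>
        (\<forall>z \<in> C_plus. F z = z\<^sup>2 * (LINT u:{0..}|lborel. Theta_integrand b \<Psi> z u))) \<and>
      Theta b \<Psi> \<in> Nevanlinna_Pick \<and>
      (\<forall>z \<in> C_plus. set_integrable lborel {0..} (Theta_integrand b \<Psi> z) \<and>
        Theta b \<Psi> z = z\<^sup>2 * (LINT u:{0..}|lborel. Theta_integrand b \<Psi> z u)) \<and>
      (\<forall>\<alpha> \<beta> \<gamma> \<nu>. LE_characteristics \<Psi> \<alpha> \<beta> \<gamma> \<nu> \<longrightarrow>
        (\<forall>z \<in> C_plus. z\<^sup>2 * (LINT u:{0..}|lborel. Theta_integrand b \<Psi> z u) =
          of_real (- \<beta>) + of_real b * z +
          (LINT x:{0..}|Theta_measure \<gamma> \<nu>. (z * of_real x - 1) / (z + of_real x))) \<and>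
        (\<forall>a b' \<rho>. NP_characteristics (Theta b \<Psi>) a b' \<rho> \<longleftrightarrow>
          a = - \<beta> \<and> b' = b \<and> \<rho> = Theta_measure \<gamma> \<nu>))) \<and>
    Nevanlinna_Pick_star = (\<lambda>(b, \<Psi>). Theta b \<Psi>) ` ({0} \<times> Levy_Laplace)"
proof (intro conjI allI impI)
  fix b :: real and \<Psi>
  assume "b \<ge> 0 \<and> \<Psi> \<in> Levy_Laplace"
  then obtain \<alpha> \<beta> \<gamma> \<nu> where b: "b \<ge> 0" and LE: "LE_characteristics \<Psi> \<alpha> \<beta> \<gamma> \<nu>"
    unfolding Levy_Laplace_def by blast
  note T = Theta_unique[OF b LE]
  show NP: "Theta b \<Psi> \<in> Nevanlinna_Pick"
    unfolding T(4) Nevanlinna_Pick_def using T(1) by blast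
  show val: "\<forall>z \<in> C_plus. set_integrable lborel {0..} (Theta_integrand b \<Psi> z) \<and>
      Theta b \<Psi> z = z\<^sup>2 * (LINT u:{0..}|lborel. Theta_integrand b \<Psi> z u)"
    unfolding T(4) using Theta_integrand_Laplace(1)[OF LE] T(2) by blast
  show "\<exists>!F. F \<in> Nevanlinna_Pick \<and>
      (\<forall>z \<in> C_plus. F z = z\<^sup>2 * (LINT u:{0..}|lborel. Theta_integrand b \<Psi> z u))"
    using NP val T(3) unfolding T(4) by blast
next
  fix b :: real and \<Psi> \<alpha> \<beta> \<gamma> \<nu>
  assume "b \<ge> 0 \<and> \<Psi> \<in> Levy_Laplace" and LE: "LE_characteristics \<Psi> \<alpha> \<beta> \<gamma> \<nu>"
  then have b: "b \<ge> 0" by simp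
  note T = Theta_unique[OF b LE]
  show "\<forall>z \<in> C_plus. z\<^sup>2 * (LINT u:{0..}|lborel. Theta_integrand b \<Psi> z u) =
      of_real (- \<beta>) + of_real b * z +
      (LINT x:{0..}|Theta_measure \<gamma> \<nu>. (z * of_real x - 1) / (z + of_real x))"
    using Theta_integrand_Laplace(2)[OF LE] by blast
  show "NP_characteristics (Theta b \<Psi>) a b' \<rho> \<longleftrightarrow> a = - \<beta> \<and> b' = b \<and> \<rho> = Theta_measure \<gamma> \<nu>" for a b' \<rho>
    using NP_characteristics_unique[OF _ T(1)] T(1) unfolding T(4) by blast
next
  show "Nevanlinna_Pick_star = (\<lambda>(b, \<Psi>). Theta b \<Psi>) ` ({0} \<times> Levy_Laplace)"
  proof (intro equalityI subsetI)
    fix F assume "F \<in> Nevanlinna_Pick_star"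
    then obtain a \<rho> where "NP_characteristics F a 0 \<rho>"
      unfolding Nevanlinna_Pick_star_def by blast
    then obtain \<Psi> where "\<Psi> \<in> Levy_Laplace" "Theta 0 \<Psi> = F" by (rule obtain_LE_preimage)
    then show "F \<in> (\<lambda>(b, \<Psi>). Theta b \<Psi>) ` ({0} \<times> Levy_Laplace)" by force
  next
    fix F assume "F \<in> (\<lambda>(b, \<Psi>). Theta b \<Psi>) ` ({0} \<times> Levy_Laplace)"
    then obtain \<Psi> \<alpha> \<beta> \<gamma> \<nu> where LE: "LE_characteristics \<Psi> \<alpha> \<beta> \<gamma> \<nu>" and F: "F = Theta 0 \<Psi>"
      unfolding Levy_Laplace_def by auto
    have "NP_characteristics F (- \<beta>) 0 (Theta_measure \<gamma> \<nu>)"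
      unfolding F Theta_unique(4)[OF order_refl LE] by (rule Theta_unique(1)[OF order_refl LE])
    moreover from this have "((\<lambda>z. F z / z) \<longlongrightarrow> of_real 0) (inf at_infinity (principal C_plus))"
      using NP_quotient_tendsto_0 by simp
    ultimately show "F \<in> Nevanlinna_Pick_star"
      unfolding Nevanlinna_Pick_star_def by blast
  qed
qed

end
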